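(* Let $\mathbb{K}$ be a field of characteristic zero. Let $H$ be a bipartite graph on $n\ge 12$ vertices and let $G=w(H)$ be the whiskering of $H$, a graph on vertex set $\{1,\dots,2n\}$. Let $$F(G)=\sum_{i=1}^m x_i u_{F_i}\in\mathbb{K}[x_1,\dots,x_m,u_1,\dots,u_{2n}],$$ where $F_1,\ldots,F_m$ are the maximal independent sets of $G$ and $u_{F_i}=\prod_{j\in F_i}u_j$. Then $F(G)$ is the Macaulay dual generator of a G-quadratic Perazzo algebra failing the weak Lefschetz property.
   Context: Whiskering: for a graph $H$ on vertex set $\{1,\dots,n\}$, $w(H)$ is the graph on $\{1,\dots,2n\}$ whose edges are the edges of $H$ together with $\{i,i+n\}$ for $1\le i\le n$. Maximal independent sets are independent vertex sets maximal under inclusion. Macaulay duality: for a polynomial ring $R=\mathbb{K}[z_1,\dots,z_N]$ acting on $S=\mathbb{K}[Z_1,\dots,Z_N]$ by $z_i=\partial/\partial Z_i$ and a form (homogeneous polynomial) $F\in S$, put $\mathrm{Ann}(F)=\{g\in R: g\circ F=0\}$. Then $A_F=R/\mathrm{Ann}(F)$ is a standard graded artinian Gorenstein algebra, and $F$ is called its Macaulay dual generator. (The rings $R$ and $S$ are identified when no confusion arises; here the variables are $x_1,\dots,x_m,u_1,\dots,u_{2n}$.) A Perazzo form is a homogeneous polynomial $F=x_1g_1+\dots+x_sg_s+g\in\mathbb{K}[x_1,\dots,x_s,u_1,\dots,u_r]$ with $g_1,\dots,g_s,g\in\mathbb{K}[u_1,\dots,u_r]$ such that the forms $g_1,\dots,g_s$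 are linearly independent and algebraically dependent over $\mathbb{K}$ ($g=0$ is allowed). A Perazzo algebra is an algebra $A_F$ with $F$ a Perazzo form. An algebra $R/I$ is G-quadratic if the ideal $I$ has a quadratic Gröbner basis. A graded artinian algebra $A$ has the weak Lefschetz property (WLP) if there is a linear form $L\in A_1$ such that every multiplication map $\times L:A_i\to A_{i+1}$ has maximal rank, i.e. is injective or surjective. *)

theory Defs
  imports
    "HOL-Library.Poly_Mapping"
    "HOL-Library.Ramsey"
    "HOL-Algebra.QuotRing"
begin

section \<open>Multivariate polynomials\<close>

abbreviation "lookup \<equiv> Poly_Mapping.lookup"
abbreviation "keys \<equiv> Poly_Mapping.keys"

text \<open>
  A monomial is a finitely supported exponent vector; a polynomial is a finitely supported
  function from monomials to coefficients. The ring operations are those of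
  \<^theory>\<open>HOL-Library.Poly_Mapping\<close>. The polynomial ring \<open>K[V]\<close> in a given set \<open>V\<close> of
  variables is the subset of those polynomials that only involve variables from \<open>V\<close>.
\<close>

type_synonym 'v monomial = "'v \<Rightarrow>\<^sub>0 nat"
type_synonym ('v, 'k) mpoly = "'v monomial \<Rightarrow>\<^sub>0 'k"

definition const :: "'k::zero \<Rightarrow> ('v, 'k) mpoly"
  where "const c = Poly_Mapping.single 0 c"

definition monom :: "'v monomial \<Rightarrow> ('v, 'k::zero_neq_one) mpoly"
  where "monom t = Poly_Mapping.single t 1"

definition var :: "'v \<Rightarrow> ('v, 'k::zero_neq_one) mpoly"
  where "var v = monom (Poly_Mapping.single v 1)"

definition monomials :: "'v set \<Rightarrow> 'v monomial set"
  where "monomials V = {t. keys t \<subseteq> V}"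

definition polys :: "'v set \<Rightarrow> ('v, 'k::zero) mpoly set"
  where "polys V = {p. keys p \<subseteq> monomials V}"

definition mpoly_ring :: "'v set \<Rightarrow> ('v, 'k::field) mpoly ring"
  where "mpoly_ring V = \<lparr>carrier = polys V, mult = (*), one = 1, zero = 0, add = (+)\<rparr>"

definition mon_degree :: "'v monomial \<Rightarrow> nat"
  where "mon_degree t = (\<Sum>v\<in>keys t. lookup t v)"

definition homogeneous :: "nat \<Rightarrow> ('v, 'k::zero) mpoly \<Rightarrow> bool"
  where "homogeneous d p \<longleftrightarrow> (\<forall>t\<in>keys p. mon_degree t = d)"

definition form :: "('v, 'k::zero) mpoly \<Rightarrow> bool"
  where "form p \<longleftrightarrow> (\<exists>d. homogeneous d p)"

text \<open>The value \<open>P(g)\<close> of \<open>P\<close> after replacing each variable \<open>i\<close> by the polynomial \<open>g i\<close>.\<close>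

definition msubst :: "('w \<Rightarrow> ('v, 'k::field) mpoly) \<Rightarrow> ('w, 'k) mpoly \<Rightarrow> ('v, 'k) mpoly"
  where "msubst g P = (\<Sum>t\<in>keys P. const (lookup P t) * (\<Prod>i\<in>keys t. g i ^ lookup t i))"

text \<open>Both notions below concern the family \<open>(g i)\<close>, \<open>i \<in> I\<close>, for a finite set \<open>I\<close>.\<close>

definition linearly_independent :: "'i set \<Rightarrow> ('i \<Rightarrow> ('v, 'k::field) mpoly) \<Rightarrow> bool"
  where "linearly_independent I g \<longleftrightarrow>
    (\<forall>c. (\<Sum>i\<in>I. const (c i) * g i) = 0 \<longrightarrow> (\<forall>i\<in>I. c i = 0))"

definition algebraically_dependent :: "'i set \<Rightarrow> ('i \<Rightarrow> ('v, 'k::field) mpoly) \<Rightarrow> bool"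
  where "algebraically_dependent I g \<longleftrightarrow> (\<exists>P\<in>polys I. P \<noteq> 0 \<and> msubst g P = 0)"


section \<open>Macaulay duality\<close>

definition partial :: "'v \<Rightarrow> ('v, 'k::field) mpoly \<Rightarrow> ('v, 'k) mpoly"
  where "partial v F =
    (\<Sum>t\<in>keys F. Poly_Mapping.single (t - Poly_Mapping.single v 1)
                   (of_nat (lookup t v) * lookup F t))"

text \<open>
  A monomial acts by the composition of the partial derivatives with respect to its variables,
  each repeated according to its exponent. The order of composition is irrelevant by lemma
  \<open>partial_power_commute\<close> below, so that the fold over the set of variables is well behaved.
\<close>

definition monomial_action :: "'v monomial \<Rightarrow> ('v, 'k::field) mpoly \<Rightarrow> ('v, 'k) mpoly"
  where "monomial_action t F = Finite_Set.fold (\<lambda>v. partial v ^^ lookup t v) F (keys t)"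

definition diff_action :: "('v, 'k::field) mpoly \<Rightarrow> ('v, 'k) mpoly \<Rightarrow> ('v, 'k) mpoly"
  where "diff_action g F = (\<Sum>t\<in>keys g. const (lookup g t) * monomial_action t F)"

definition Ann :: "'v set \<Rightarrow> ('v, 'k::field) mpoly \<Rightarrow> ('v, 'k) mpoly set"
  where "Ann V F = {g \<in> polys V. diff_action g F = 0}"

text \<open>The algebra \<open>A\<^sub>F = K[V] / Ann(F)\<close>, whose Macaulay dual generator is \<open>F\<close>.\<close>

definition macaulay_algebra :: "'v set \<Rightarrow> ('v, 'k::field) mpoly \<Rightarrow> ('v, 'k) mpoly set ring"
  where "macaulay_algebra V F = mpoly_ring V Quot Ann V F"

text \<open>The standard grading of \<open>K[V] / I\<close>: degree \<open>i\<close> is the image of the forms of degree \<open>i\<close>.\<close>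

definition graded_piece :: "'v set \<Rightarrow> ('v, 'k::field) mpoly set \<Rightarrow> nat \<Rightarrow> ('v, 'k) mpoly set set"
  where "graded_piece V I i =
    (\<lambda>p. I +>\<^bsub>mpoly_ring V\<^esub> p) ` {p \<in> polys V. homogeneous i p}"

text \<open>The weak Lefschetz property of a ring \<open>A\<close> with graded pieces \<open>gr i\<close>.\<close>

definition weak_Lefschetz :: "('a, 'b) ring_scheme \<Rightarrow> (nat \<Rightarrow> 'a set) \<Rightarrow> bool"
  where "weak_Lefschetz A gr \<longleftrightarrow>
    (\<exists>L\<in>gr 1. \<forall>i. inj_on (\<lambda>a. L \<otimes>\<^bsub>A\<^esub> a) (gr i) \<or>
                  (\<lambda>a. L \<otimes>\<^bsub>A\<^esub> a) ` gr i = gr (i + 1))"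


section \<open>Quadratic Groebner bases\<close>

text \<open>For finite \<open>V\<close> such an order is automatically a well-order.\<close>

definition monomial_order :: "'v set \<Rightarrow> 'v monomial rel \<Rightarrow> bool"
  where "monomial_order V r \<longleftrightarrow>
    linear_order_on (monomials V) r \<and>
    (\<forall>t\<in>monomials V. (0, t) \<in> r) \<and>
    (\<forall>s t u. (s, t) \<in> r \<longrightarrow> u \<in> monomials V \<longrightarrow> (s + u, t + u) \<in> r)"

definition leading_monomial :: "'v monomial rel \<Rightarrow> ('v, 'k::zero) mpoly \<Rightarrow> 'v monomial"
  where "leading_monomial r p = (THE t. t \<in> keys p \<and> (\<forall>s\<in>keys p. (s, t) \<in> r))"

text \<open>
  The ideal generated by the leading monomials of the nonzero elements of a set of polynomials.
  (\<^const>\<open>genideal\<close> is only meaningful over a ring; see lemma \<open>mpoly_ring_cring\<close>.)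
\<close>

definition initial_ideal ::
    "'v set \<Rightarrow> 'v monomial rel \<Rightarrow> ('v, 'k::field) mpoly set \<Rightarrow> ('v, 'k) mpoly set"
  where "initial_ideal V r S =
    Idl\<^bsub>mpoly_ring V\<^esub> ((\<lambda>p. monom (leading_monomial r p)) ` (S - {0}))"

definition groebner_basis ::
    "'v set \<Rightarrow> 'v monomial rel \<Rightarrow> ('v, 'k::field) mpoly set \<Rightarrow> ('v, 'k) mpoly set \<Rightarrow> bool"
  where "groebner_basis V r I B \<longleftrightarrow>
    finite B \<and> B \<subseteq> I - {0} \<and> initial_ideal V r B = initial_ideal V r I"

text \<open>\<open>K[V] / I\<close> is G-quadratic.\<close>

definition G_quadratic :: "'v set \<Rightarrow> ('v, 'k::field) mpoly set \<Rightarrow> bool"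
  where "G_quadratic V I \<longleftrightarrow>
    (\<exists>r B. monomial_order V r \<and> groebner_basis V r I B \<and> (\<forall>b\<in>B. homogeneous 2 b))"


section \<open>Perazzo forms\<close>

datatype pvar = Xvar nat | Uvar nat

definition xu_vars :: "nat \<Rightarrow> nat \<Rightarrow> pvar set"
  where "xu_vars s r = Xvar ` {1..s} \<union> Uvar ` {1..r}"

definition perazzo_form :: "nat \<Rightarrow> nat \<Rightarrow> (pvar, 'k::field) mpoly \<Rightarrow> bool"
  where "perazzo_form s r F \<longleftrightarrow>
    form F \<and>
    (\<exists>g h. (\<forall>i\<in>{1..s}. g i \<in> polys (Uvar ` {1..r}) \<and> form (g i)) \<and>
           h \<in> polys (Uvar ` {1..r}) \<and>
           F = (\<Sum>i=1..s. var (Xvar i) * g i) + h \<and>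
           linearly_independent {1..s} g \<and>
           algebraically_dependent {1..s} g)"


section \<open>Graphs\<close>

text \<open>A simple graph on the vertex set \<open>V\<close> is given by its set of edges, which are 2-subsets of \<open>V\<close>.\<close>

definition simple_graph :: "'a set \<Rightarrow> 'a set set \<Rightarrow> bool"
  where "simple_graph V E \<longleftrightarrow> finite V \<and> E \<subseteq> [V]\<^bsup>2\<^esup>"

definition bipartite :: "'a set \<Rightarrow> 'a set set \<Rightarrow> bool"
  where "bipartite V E \<longleftrightarrow>
    (\<exists>A B. A \<union> B = V \<and> A \<inter> B = {} \<and> (\<forall>e\<in>E. \<exists>a\<in>A. \<exists>b\<in>B. e = {a, b}))"

text \<open>The edges of \<open>w(H)\<close> for a graph \<open>H\<close> on \<open>{1..n}\<close>; its vertex set is \<open>{1..2*n}\<close>.\<close>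

definition whiskering :: "nat \<Rightarrow> nat set set \<Rightarrow> nat set set"
  where "whiskering n E = E \<union> {{i, i + n} |i. i \<in> {1..n}}"

definition max_indep_sets :: "'a set \<Rightarrow> 'a set set \<Rightarrow> 'a set set"
  where "max_indep_sets V E =
    {S. S \<subseteq> V \<and> indep S E \<and> (\<forall>T. S \<subset> T \<and> T \<subseteq> V \<longrightarrow> \<not> indep T E)}"

definition graph_form :: "nat \<Rightarrow> (nat \<Rightarrow> nat set) \<Rightarrow> (pvar, 'k::field) mpoly"
  where "graph_form m Fs = (\<Sum>i=1..m. var (Xvar i) * (\<Prod>j\<in>Fs i. var (Uvar j)))"


section \<open>Well-definedness\<close>

lemma polys_mult_closed:
  assumes "p \<in> polys V" "q \<in> polys V"
  shows "p * q \<in> polys V"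
proof -
  have "t \<in> monomials V" if t: "t \<in> keys (p * q)" for t
  proof -
    obtain a b where "t = a + b" "a \<in> keys p" "b \<in> keys q"
      using t keys_mult[of p q] by blast
    then show ?thesis
      using assms keys_add[of a b] by (fastforce simp: polys_def monomials_def)
  qed
  then show ?thesis by (auto simp: polys_def)
qed

lemma polys_add_closed: "p \<in> polys V \<Longrightarrow> q \<in> polys V \<Longrightarrow> p + q \<in> polys V"
  using keys_add[of p q] by (fastforce simp: polys_def)

lemma mpoly_ring_cring: "cring (mpoly_ring V :: ('v, 'k::field) mpoly ring)"
proof (intro cringI abelian_groupI comm_monoidI)
  fix x :: "('v, 'k) mpoly"
  assume "x \<in> carrier (mpoly_ring V)"
  then show "\<exists>y\<in>carrier (mpoly_ring V). y \<oplus>\<^bsub>mpoly_ring V\<^esub> x = \<zero>\<^bsub>mpoly_ring V\<^esub>"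
    by (intro bexI[of _ "- x"]) (auto simp: mpoly_ring_def polys_def)
qed (auto simp: mpoly_ring_def polys_mult_closed polys_add_closed algebra_simps,
     auto simp: polys_def monomials_def)

lemma lookup_partial:
  "lookup (partial v F) s = of_nat (lookup s v + 1) * lookup F (s + Poly_Mapping.single v 1)"
proof -
  let ?e = "Poly_Mapping.single v (1::nat)"
  have eq: "lookup (Poly_Mapping.single (t - ?e) (of_nat (lookup t v) * lookup F t)) s =
      (if t = s + ?e then of_nat (lookup t v) * lookup F t else 0)" for t
  proof (cases "lookup t v = 0")
    case True
    then have "t \<noteq> s + ?e" by (auto simp: lookup_add)
    with True show ?thesis by simp
  next
    case False
    then have "(t - ?e = s) = (t = s + ?e)"
      by (fastforce simp: poly_mapping_eq_iff fun_eq_iff lookup_minus lookup_add lookup_single when_def)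
    then show ?thesis by (auto simp: lookup_single when_def)
  qed
  show ?thesis
    unfolding partial_def lookup_sum eq by (simp add: lookup_add in_keys_iff)
qed

lemma partial_commute: "partial v (partial w F) = partial w (partial v F)"
proof (rule poly_mapping_eqI)
  fix s
  show "lookup (partial v (partial w F)) s = lookup (partial w (partial v F)) s"
    by (cases "v = w") (simp_all add: lookup_partial lookup_add lookup_single add_ac mult_ac)
qed

lemma partial_power_commute:
  fixes v w :: 'v
  shows "(partial v ^^ a) \<circ> (partial w ^^ b) =
    ((partial w ^^ b) \<circ> (partial v ^^ a) :: ('v, 'k::field) mpoly \<Rightarrow> _)"
proof -
  have 1: "partial v ((partial w ^^ b) F) = (partial w ^^ b) (partial v F)" for F :: "('v, 'k) mpoly"
    by (induction b) (simp_all add: partial_commute[of v w])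
  have "(partial v ^^ a) ((partial w ^^ b) F) = (partial w ^^ b) ((partial v ^^ a) F)"
      for F :: "('v, 'k) mpoly"
    by (induction a) (simp_all add: 1)
  then show ?thesis by (simp add: fun_eq_iff)
qed

lemma monomial_action_comp_fun_commute:
  "comp_fun_commute (\<lambda>v. partial v ^^ lookup t v)"
  by unfold_locales (rule partial_power_commute)

end

theory Submission
  imports Complex_Main Defs
begin

text \<open>
  The form \<open>F\<close> is a sum of squarefree monomials \<open>x\<^sub>k u\<^bsub>F\<^sub>k\<^esub>\<close>, where the \<open>F\<^sub>k\<close> correspond to the independent
  sets \<open>T\<close> of \<open>H\<close> by \<open>F\<^sub>k = T \<union> {i + n | i \<notin> T}\<close>. Differentiating \<open>F\<close> therefore only compares subsets of
  the supports of these monomials.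

  With respect to a lexicographic order in which \<open>u\<^sub>1, \<dots>, u\<^sub>n\<close> come first, the initial ideal of \<open>Ann F\<close> is
  generated by the quadratic monomials in \<open>Ann F\<close> and the leading monomials \<open>x\<^sub>T u\<^sub>i\<close> of the binomials
  \<open>x\<^sub>T u\<^sub>i - x\<^bsub>T - {i}\<^esub> u\<^bsub>i + n\<^esub>\<close>, \<open>i \<in> T\<close>. An element of \<open>Ann F\<close> whose leading monomial avoids all of them
  has a vanishing leading coefficient, since one coefficient of its action on \<open>F\<close> involves, apart
  from the leading coefficient, only larger monomials.

  The part of \<open>A\<^sub>F\<close> in \<open>x\<close>-degree \<open>0\<close> and \<open>u\<close>-degree \<open>j\<close> has the faces with \<open>j\<close> vertices of the complex of
  the \<open>F\<^sub>k\<close> as a basis, and it is dual to the part in \<open>x\<close>-degree \<open>1\<close> and \<open>u\<close>-degree \<open>n - j\<close>. Hence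
  multiplication by a linear form in degree \<open>i\<close> is not surjective if there are more faces with
  \<open>i + 1\<close> than with \<open>i\<close> vertices, and not injective if there are more with \<open>n - i + 1\<close> than with
  \<open>n - i\<close>. Both hold for \<open>i = \<lceil>n/2\<rceil>\<close>: the number of faces with \<open>k\<close> vertices is
  \<open>\<Sum>\<^sub>j c\<^sub>j (n - j choose n - k)\<close> for the number \<open>c\<^sub>j\<close> of independent \<open>j\<close>-sets of \<open>H\<close>, which is at least
  \<open>\<lceil>n/2\<rceil> choose j\<close> as one side of the bipartition is independent, and the differences of binomial
  coefficients involved are Catalan numbers.
\<close>

section \<open>Squarefree monomials\<close>

text \<open>For infinite \<open>X\<close> the sum defaults to \<open>0\<close>; hence the finiteness
  conditions in most of the facts below.\<close>

definition sqf :: "'v set \<Rightarrow> 'v monomial"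
  where "sqf X = (\<Sum>v\<in>X. Poly_Mapping.single v 1)"

lemma lookup_sqf: "finite X \<Longrightarrow> lookup (sqf X) v = (if v \<in> X then 1 else 0)"
  unfolding sqf_def lookup_sum by (simp add: lookup_single when_def)

lemma keys_sqf [simp]: "finite X \<Longrightarrow> keys (sqf X) = X"
  by (auto simp: in_keys_iff lookup_sqf split: if_splits)

lemma sqf_inject: "finite X \<Longrightarrow> finite Y \<Longrightarrow> sqf X = sqf Y \<longleftrightarrow> X = Y"
  using keys_sqf by metis

lemma sqf_empty [simp]: "sqf {} = 0"
  by (simp add: sqf_def)

lemma sqf_singleton [simp]: "sqf {v} = Poly_Mapping.single v 1"
  by (simp add: sqf_def)

lemma sqf_Un: "finite X \<Longrightarrow> finite Y \<Longrightarrow> X \<inter> Y = {} \<Longrightarrow> sqf (X \<union> Y) = sqf X + sqf Y"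
  unfolding sqf_def by (rule sum.union_disjoint)

lemma sqf_insert: "finite X \<Longrightarrow> v \<notin> X \<Longrightarrow> sqf (insert v X) = Poly_Mapping.single v 1 + sqf X"
  by (simp add: sqf_def)

lemma sqf_in_monomials: "finite X \<Longrightarrow> sqf X \<in> monomials V \<longleftrightarrow> X \<subseteq> V"
  by (simp add: monomials_def)

lemma mon_degree_sqf: "finite X \<Longrightarrow> mon_degree (sqf X) = card X"
  by (simp add: mon_degree_def lookup_sqf)

lemma sqf_of_squarefree:
  assumes "\<And>v. lookup t v \<le> 1"
  shows "t = sqf (keys t)"
proof (rule poly_mapping_eqI)
  fix v show "lookup t v = lookup (sqf (keys t)) v"
    using assms[of v] by (auto simp: lookup_sqf in_keys_iff)
qed

text \<open>In each variable the exponents of \<open>s\<close> and \<open>t\<close> are natural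
  numbers with sum at most 1, so both monomials are squarefree with disjoint supports.\<close>

lemma sum_eq_sqfD:
  assumes "s + t = sqf X" "finite X"
  shows "\<exists>Y\<subseteq>X. s = sqf Y \<and> t = sqf (X - Y)"
proof -
  have le: "lookup s v + lookup t v = (if v \<in> X then 1 else 0)" for v
    using arg_cong[OF assms(1), of "\<lambda>u. lookup u v"] assms(2) by (simp add: lookup_add lookup_sqf)
  have *: "lookup s v \<le> 1" "lookup t v \<le> 1" for v
    using le[of v] by (auto split: if_splits)
  have "keys t = X - keys s"
  proof (rule Set.set_eqI)
    fix v show "v \<in> keys t \<longleftrightarrow> v \<in> X - keys s"
      using le[of v] by (auto simp: in_keys_iff split: if_splits)
  qed
  moreover have "keys s \<subseteq> X"
    using le by (fastforce simp: in_keys_iff split: if_splits)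
  ultimately show ?thesis
    using sqf_of_squarefree[OF *(1)] sqf_of_squarefree[OF *(2)] by metis
qed

lemma sqf_split: "finite X \<Longrightarrow> Y \<subseteq> X \<Longrightarrow> sqf Y + sqf (X - Y) = sqf X"
  by (subst sqf_Un[symmetric]) (auto intro: finite_subset simp: Un_absorb1)

lemma add_eq_sqf_iff:
  assumes "finite X" "finite Y"
  shows "sqf Y + t = sqf X \<longleftrightarrow> Y \<subseteq> X \<and> t = sqf (X - Y)"
proof
  assume eq: "sqf Y + t = sqf X"
  from sum_eq_sqfD[OF eq assms(1)] obtain Z where "Z \<subseteq> X" "sqf Y = sqf Z" "t = sqf (X - Z)"
    by blast
  moreover have "Y = Z"
    using calculation assms by (metis finite_subset sqf_inject)
  ultimately show "Y \<subseteq> X \<and> t = sqf (X - Y)" by simp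
qed (use sqf_split assms in auto)

section \<open>Coefficients of products at squarefree monomials\<close>

lemma poly_mapping_sum_single:
  fixes p :: "'a \<Rightarrow>\<^sub>0 'b::comm_monoid_add"
  shows "(\<Sum>t\<in>keys p. Poly_Mapping.single t (lookup p t)) = p"
proof (rule poly_mapping_eqI)
  fix s
  show "lookup (\<Sum>t\<in>keys p. Poly_Mapping.single t (lookup p t)) s = lookup p s"
    by (simp add: lookup_sum lookup_single when_def in_keys_iff)
qed

lemma lookup_mult_sum:
  fixes p q :: "('v, 'k::comm_ring_1) mpoly"
  shows "lookup (p * q) u =
    (\<Sum>(s, t)\<in>keys p \<times> keys q. if s + t = u then lookup p s * lookup q t else 0)"
proof -
  have "p * q = (\<Sum>s\<in>keys p. Poly_Mapping.single s (lookup p s)) *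
                (\<Sum>t\<in>keys q. Poly_Mapping.single t (lookup q t))"
    by (simp only: poly_mapping_sum_single)
  also have "\<dots> = (\<Sum>(s, t)\<in>keys p \<times> keys q. Poly_Mapping.single (s + t) (lookup p s * lookup q t))"
    by (simp add: sum_product sum.cartesian_product mult_single)
  finally show ?thesis
    by (simp add: lookup_sum lookup_single when_def case_prod_beta)
qed

text \<open>The factorisations of a squarefree monomial are the splittings of its support into two
  complementary parts.\<close>

lemma lookup_mult_sqf:
  fixes p q :: "('v, 'k::comm_ring_1) mpoly"
  assumes X: "finite X"
  shows "lookup (p * q) (sqf X) = (\<Sum>Y\<in>Pow X. lookup p (sqf Y) * lookup q (sqf (X - Y)))"
proof -
  let ?D = "(\<lambda>Y. (sqf Y, sqf (X - Y))) ` Pow X"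
  have inj: "inj_on (\<lambda>Y. (sqf Y, sqf (X - Y))) (Pow X)"
    by (rule inj_onI) (use X in \<open>auto simp: sqf_inject finite_subset\<close>)
  have D: "(s, t) \<in> ?D \<longleftrightarrow> s + t = sqf X" for s t
    using sum_eq_sqfD[of s t X] sqf_split[OF X] X by auto
  have "lookup (p * q) (sqf X) =
      (\<Sum>(s, t)\<in>keys p \<times> keys q. if s + t = sqf X then lookup p s * lookup q t else 0)"
    by (rule lookup_mult_sum)
  also have "\<dots> = (\<Sum>(s, t)\<in>(keys p \<times> keys q) \<inter> ?D. lookup p s * lookup q t)"
    unfolding case_prod_beta
    by (subst sum.inter_restrict) (auto intro!: sum.cong simp: D split: if_splits)
  also have "\<dots> = (\<Sum>(s, t)\<in>?D. lookup p s * lookup q t)"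
    by (rule sum.mono_neutral_left) (use X in \<open>auto simp: in_keys_iff\<close>)
  also have "\<dots> = (\<Sum>Y\<in>Pow X. lookup p (sqf Y) * lookup q (sqf (X - Y)))"
    by (simp add: sum.reindex[OF inj])
  finally show ?thesis .
qed

lemma lookup_const_mult:
  fixes p :: "('v, 'k::comm_ring_1) mpoly"
  shows "lookup (const c * p) s = c * lookup p s"
  unfolding const_def mult_map_scale_conv_mult[symmetric]
  by (simp add: map.rep_eq when_def)

lemma monom_mult: "monom s * monom t = (monom (s + t) :: ('v, 'k::comm_ring_1) mpoly)"
  by (simp add: monom_def mult_single)

lemma lookup_monom: "lookup (monom t) s = (if s = t then 1 else 0)"
  by (auto simp: monom_def lookup_single when_def)

lemma prod_var:
  assumes "finite X"
  shows "(\<Prod>v\<in>X. var v) = (monom (sqf X) :: ('v, 'k::comm_ring_1) mpoly)"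
  using assms by (induction X)
    (simp_all add: var_def monom_mult sqf_insert, simp add: monom_def)

lemma prod_var_image:
  assumes "finite X" "inj_on f X"
  shows "(\<Prod>j\<in>X. var (f j)) = (monom (sqf (f ` X)) :: ('v, 'k::comm_ring_1) mpoly)"
  using assms by (simp add: prod_var[symmetric] prod.reindex)

section \<open>The differential action on squarefree polynomials\<close>

text \<open>Differentiating such a polynomial produces no numerical factors, so the action is plain
  contraction of monomials.\<close>

definition squarefree_support :: "('v, 'k::zero) mpoly \<Rightarrow> bool"
  where "squarefree_support F \<longleftrightarrow> (\<forall>t\<in>keys F. \<forall>v. lookup t v \<le> 1)"

text \<open>Iterated derivatives stay squarefree, which lets the inductions below treat one
  derivative at a time.\<close>

lemma squarefree_support_shift:
  assumes "squarefree_support F" "\<And>s. lookup G s = lookup F (s + t)"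
  shows "squarefree_support G"
proof -
  have "lookup s v \<le> 1" if "s \<in> keys G" for s v
  proof -
    have "s + t \<in> keys F" using that assms(2) by (simp add: in_keys_iff)
    then have "lookup (s + t) v \<le> 1" using assms(1) by (simp add: squarefree_support_def)
    then show ?thesis by (simp add: lookup_add)
  qed
  then show ?thesis by (simp add: squarefree_support_def)
qed

text \<open>If \<open>s + Poly_Mapping.single v 1\<close> occurs in \<open>F\<close>, then
  \<open>s\<close> has exponent 0 in \<open>v\<close> and the factor \<open>lookup s v + 1\<close>
  is 1; otherwise both sides vanish.\<close>

lemma lookup_partial_squarefree:
  assumes "squarefree_support F"
  shows "lookup (partial v F) s = lookup F (s + Poly_Mapping.single v 1)"
proof (cases "s + Poly_Mapping.single v 1 \<in> keys F")
  case True
  then have "lookup (s + Poly_Mapping.single v 1) v \<le> 1"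
    using assms by (simp add: squarefree_support_def)
  then have "lookup s v = 0" by (simp add: lookup_add)
  then show ?thesis by (simp add: lookup_partial)
qed (simp add: lookup_partial in_keys_iff)

lemma lookup_partial_power_squarefree:
  assumes "squarefree_support F"
  shows "lookup ((partial v ^^ a) F) s = lookup F (s + Poly_Mapping.single v a)"
proof (induction a arbitrary: s)
  case (Suc a)
  have "lookup ((partial v ^^ Suc a) F) s = lookup ((partial v ^^ a) F) (s + Poly_Mapping.single v 1)"
    using lookup_partial_squarefree[OF squarefree_support_shift[OF assms Suc.IH]] by simp
  also have "\<dots> = lookup F (s + Poly_Mapping.single v 1 + Poly_Mapping.single v a)"
    by (rule Suc.IH)
  also have "s + Poly_Mapping.single v 1 + Poly_Mapping.single v a = s + Poly_Mapping.single v (Suc a)"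
    by (simp add: add.assoc flip: single_add)
  finally show ?case .
qed simp

lemma lookup_monomial_action_squarefree:
  assumes "squarefree_support F"
  shows "lookup (monomial_action t F) s = lookup F (s + t)"
proof -
  interpret comp_fun_commute "\<lambda>v. partial v ^^ lookup t v"
    by (rule monomial_action_comp_fun_commute)
  \<comment> \<open>Generalised from \<open>keys t\<close> to any finite \<open>A\<close>, to allow
    induction on the set.\<close>
  have "lookup (Finite_Set.fold (\<lambda>v. partial v ^^ lookup t v) F A) s =
      lookup F (s + (\<Sum>v\<in>A. Poly_Mapping.single v (lookup t v)))" if "finite A" for A s
    using that
  proof (induction A arbitrary: s)
    case (insert v A)
    show ?case
      using insert lookup_partial_power_squarefree[OF squarefree_support_shift[OF assms insert.IH]]
      by (simp add: add.assoc insert.IH)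
  qed simp
  then show ?thesis
    by (simp add: monomial_action_def poly_mapping_sum_single)
qed

lemma lookup_diff_action_squarefree:
  assumes "squarefree_support F"
  shows "lookup (diff_action g F) s = (\<Sum>t\<in>keys g. lookup g t * lookup F (s + t))"
  by (simp add: diff_action_def lookup_sum lookup_const_mult lookup_monomial_action_squarefree[OF assms])

section \<open>The pairing with the form of a family of facets\<close>

locale facet_form =
  fixes m N :: nat and Fs :: "nat \<Rightarrow> nat set"
  assumes facet_subset: "k \<in> {1..m} \<Longrightarrow> Fs k \<subseteq> {1..N}"
begin

abbreviation V :: "pvar set"
  where "V \<equiv> xu_vars m N"

text \<open>The support of the \<open>k\<close>-th monomial of the form.\<close>

definition W :: "nat \<Rightarrow> pvar set"
  where "W k = insert (Xvar k) (Uvar ` Fs k)"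

text \<open>The coefficient of \<open>sqf Y\<close> after \<open>g\<close> has acted on the form, by
  \<open>lookup_diff_action_sqf\<close>; with it, membership in the annihilator becomes a statement
  about subsets of the \<open>W k\<close>.\<close>

definition pairing :: "(pvar, 'k::comm_ring_1) mpoly \<Rightarrow> pvar set \<Rightarrow> 'k"
  where "pairing g Y = (\<Sum>k | k \<in> {1..m} \<and> Y \<subseteq> W k. lookup g (sqf (W k - Y)))"

lemma finite_V [simp]: "finite V"
  by (simp add: xu_vars_def)

lemma finite_facet: "k \<in> {1..m} \<Longrightarrow> finite (Fs k)"
  using facet_subset finite_subset by blast

lemma finite_W: "k \<in> {1..m} \<Longrightarrow> finite (W k)"
  by (simp add: W_def finite_facet)

lemma W_subset: "k \<in> {1..m} \<Longrightarrow> W k \<subseteq> V"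
  using facet_subset[of k] by (auto simp: W_def xu_vars_def)

lemma Xvar_in_W [simp]: "Xvar l \<in> W k \<longleftrightarrow> l = k"
  by (auto simp: W_def)

lemma Uvar_in_W [simp]: "Uvar j \<in> W k \<longleftrightarrow> j \<in> Fs k"
  by (auto simp: W_def)

lemma graph_form_monoms:
  "graph_form m Fs = (\<Sum>k=1..m. monom (sqf (W k)) :: (pvar, 'k::field) mpoly)"
  unfolding graph_form_def
proof (rule sum.cong)
  fix k assume k: "k \<in> {1..m}"
  have "monom (sqf (W k)) = (\<Prod>v\<in>W k. var v :: (pvar, 'k) mpoly)"
    using finite_W[OF k] by (simp add: prod_var)
  also have "\<dots> = var (Xvar k) * (\<Prod>v\<in>Uvar ` Fs k. var v)"
    unfolding W_def by (subst prod.insert) (use finite_facet[OF k] in auto)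
  also have "(\<Prod>v\<in>Uvar ` Fs k. var v :: (pvar, 'k) mpoly) = (\<Prod>j\<in>Fs k. var (Uvar j))"
    by (subst prod.reindex) (auto simp: inj_on_def)
  finally show "var (Xvar k) * (\<Prod>j\<in>Fs k. var (Uvar j)) = (monom (sqf (W k)) :: (pvar, 'k) mpoly)"
    by simp
qed simp

lemma lookup_graph_form:
  "lookup (graph_form m Fs :: (pvar, 'k::field) mpoly) s = (\<Sum>k=1..m. if s = sqf (W k) then 1 else 0)"
  by (simp add: graph_form_monoms lookup_sum lookup_monom)

lemma keys_graph_form: "keys (graph_form m Fs :: (pvar, 'k::field) mpoly) \<subseteq> (\<lambda>k. sqf (W k)) ` {1..m}"
proof
  fix s assume s: "s \<in> keys (graph_form m Fs :: (pvar, 'k) mpoly)"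
  show "s \<in> (\<lambda>k. sqf (W k)) ` {1..m}"
  proof (rule ccontr)
    assume "s \<notin> (\<lambda>k. sqf (W k)) ` {1..m}"
    then have "lookup (graph_form m Fs :: (pvar, 'k) mpoly) s = 0"
      unfolding lookup_graph_form by (intro sum.neutral) auto
    with s show False by (simp add: in_keys_iff)
  qed
qed

lemma squarefree_support_graph_form: "squarefree_support (graph_form m Fs :: (pvar, 'k::field) mpoly)"
  unfolding squarefree_support_def
proof (intro ballI allI)
  fix t v assume "t \<in> keys (graph_form m Fs :: (pvar, 'k) mpoly)"
  then obtain k where "k \<in> {1..m}" "t = sqf (W k)" using keys_graph_form by blast
  then show "lookup t v \<le> 1" by (simp add: lookup_sqf finite_W)
qed

lemma lookup_diff_action_graph_form:
  fixes g :: "(pvar, 'k::field) mpoly"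
  shows "lookup (diff_action g (graph_form m Fs)) s =
    (\<Sum>k=1..m. \<Sum>t\<in>keys g. if s + t = sqf (W k) then lookup g t else 0)"
  unfolding lookup_diff_action_squarefree[OF squarefree_support_graph_form] lookup_graph_form
  by (subst sum.swap, intro sum.cong refl) (simp add: sum_distrib_left if_distrib cong: if_cong)

lemma lookup_diff_action_sqf:
  fixes g :: "(pvar, 'k::field) mpoly"
  assumes "finite Y"
  shows "lookup (diff_action g (graph_form m Fs)) (sqf Y) = pairing g Y"
proof -
  have "(\<Sum>t\<in>keys g. if sqf Y + t = sqf (W k) then lookup g t else 0) =
      (if Y \<subseteq> W k then lookup g (sqf (W k - Y)) else 0)" if "k \<in> {1..m}" for k
    unfolding add_eq_sqf_iff[OF finite_W[OF that] assms]
    by (cases "Y \<subseteq> W k") (simp_all add: in_keys_iff)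
  then show ?thesis
    unfolding lookup_diff_action_graph_form pairing_def
    by (subst sum.inter_filter) auto
qed

lemma diff_action_graph_form_eq_0_iff:
  fixes g :: "(pvar, 'k::field) mpoly"
  shows "diff_action g (graph_form m Fs) = 0 \<longleftrightarrow> (\<forall>Y. finite Y \<longrightarrow> pairing g Y = 0)"
proof
  assume R: "\<forall>Y. finite Y \<longrightarrow> pairing g Y = 0"
  show "diff_action g (graph_form m Fs) = 0"
  proof (rule poly_mapping_eqI)
    fix s
    show "lookup (diff_action g (graph_form m Fs)) s = lookup 0 s"
    proof (cases "\<exists>Y. finite Y \<and> s = sqf Y")
      case True
      then show ?thesis using R lookup_diff_action_sqf[of _ g] by auto
    next
      case False
      \<comment> \<open>Divisors of squarefree monomials are squarefree, so at all other monomials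
        the coefficient vanishes by itself.\<close>
      have "s + t \<noteq> sqf (W k)" if "k \<in> {1..m}" for k t
        using False sum_eq_sqfD[of s t "W k"] finite_W[OF that] by (meson finite_subset)
      then show ?thesis
        unfolding lookup_diff_action_graph_form by simp
    qed
  qed
qed (metis lookup_diff_action_sqf lookup_zero)

lemma Ann_graph_form_iff:
  fixes g :: "(pvar, 'k::field) mpoly"
  shows "g \<in> Ann V (graph_form m Fs) \<longleftrightarrow> g \<in> polys V \<and> (\<forall>Y. finite Y \<longrightarrow> pairing g Y = 0)"
  by (simp add: Ann_def diff_action_graph_form_eq_0_iff)

lemma pairing_add: "pairing (g + h) Y = pairing g Y + pairing h Y"
  by (simp add: pairing_def lookup_add sum.distrib)

lemma pairing_diff: "pairing (g - h) Y = pairing g Y - pairing h Y"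
  by (simp add: pairing_def lookup_minus sum_subtractf)

lemma pairing_sum: "pairing (\<Sum>i\<in>I. f i) Y = (\<Sum>i\<in>I. pairing (f i) Y)"
  unfolding pairing_def lookup_sum by (rule sum.swap)

lemma pairing_const_mult: "pairing (const c * g) Y = c * pairing g Y"
  by (simp add: pairing_def lookup_const_mult sum_distrib_left)

text \<open>Coefficientwise form of the module law: acting by \<open>h * g\<close> is acting by
  \<open>g\<close> and then by \<open>h\<close>. The part of \<open>W k\<close> outside
  \<open>Y\<close> is split into \<open>Z\<close>, taken by \<open>h\<close>, and the rest, taken by
  \<open>g\<close>.\<close>

lemma pairing_mult:
  assumes "finite Y"
  shows "pairing (h * g) Y = (\<Sum>Z\<in>Pow (V - Y). lookup h (sqf Z) * pairing g (Y \<union> Z))"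
proof -
  have "pairing (h * g) Y = (\<Sum>k | k \<in> {1..m} \<and> Y \<subseteq> W k. \<Sum>Z\<in>Pow (W k - Y).
      lookup h (sqf Z) * lookup g (sqf (W k - Y - Z)))"
    unfolding pairing_def by (intro sum.cong refl lookup_mult_sqf) (auto simp: finite_W)
  \<comment> \<open>The range of \<open>Z\<close> is put inside \<open>V - Y\<close>, which does not
    depend on \<open>k\<close>, so that the sums can be interchanged.\<close>
  also have "\<dots> = (\<Sum>k | k \<in> {1..m} \<and> Y \<subseteq> W k. \<Sum>Z | Z \<in> Pow (V - Y) \<and> Z \<subseteq> W k.
      lookup h (sqf Z) * lookup g (sqf (W k - Y - Z)))"
    by (intro sum.cong refl) (use W_subset in auto)
  also have "\<dots> = (\<Sum>k=1..m. if Y \<subseteq> W k then \<Sum>Z\<in>Pow (V - Y). if Z \<subseteq> W k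
      then lookup h (sqf Z) * lookup g (sqf (W k - Y - Z)) else 0 else 0)"
    by (simp only: sum.inter_filter finite_atLeastAtMost finite_Pow_iff finite_Diff finite_V)
  also have "\<dots> = (\<Sum>k=1..m. \<Sum>Z\<in>Pow (V - Y). if Y \<union> Z \<subseteq> W k
      then lookup h (sqf Z) * lookup g (sqf (W k - (Y \<union> Z))) else 0)"
    by (intro sum.cong refl) (auto simp: Set.Diff_eq Int_assoc intro!: sum.cong)
  also have "\<dots> = (\<Sum>Z\<in>Pow (V - Y). \<Sum>k=1..m. if Y \<union> Z \<subseteq> W k
      then lookup h (sqf Z) * lookup g (sqf (W k - (Y \<union> Z))) else 0)"
    by (rule sum.swap)
  also have "\<dots> = (\<Sum>Z\<in>Pow (V - Y). lookup h (sqf Z) * pairing g (Y \<union> Z))"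
    unfolding pairing_def
    by (intro sum.cong refl) (simp only: sum_distrib_left sum.inter_filter finite_atLeastAtMost,
      intro sum.cong refl, simp)
  finally show ?thesis .
qed

lemma pairing_monom:
  assumes "finite X"
  shows "pairing (monom (sqf X) :: (pvar, 'k::comm_ring_1) mpoly) Y =
    of_nat (card {k \<in> {1..m}. Y \<subseteq> W k \<and> X = W k - Y})"
proof -
  have "pairing (monom (sqf X) :: (pvar, 'k) mpoly) Y =
      (\<Sum>k | k \<in> {1..m} \<and> Y \<subseteq> W k. if X = W k - Y then 1 else 0)"
    unfolding pairing_def lookup_monom
    by (intro sum.cong refl) (auto simp: sqf_inject assms finite_W)
  also have "\<dots> = (\<Sum>k | k \<in> {1..m} \<and> Y \<subseteq> W k \<and> X = W k - Y. 1)"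
    by (subst sum.inter_filter[symmetric], simp, intro sum.cong) auto
  finally show ?thesis by simp
qed

text \<open>The variable \<open>Xvar k\<close> lies in no other \<open>W l\<close>, so a monomial
  containing it meets only the \<open>k\<close>-th summand of the form.\<close>

lemma pairing_monom_Xvar:
  assumes k: "k \<in> {1..m}" and X: "Xvar k \<in> X" "X \<subseteq> W k"
  shows "pairing (monom (sqf X) :: (pvar, 'k::comm_ring_1) mpoly) Y = (if Y = W k - X then 1 else 0)"
proof -
  have "{l \<in> {1..m}. Y \<subseteq> W l \<and> X = W l - Y} = (if Y = W k - X then {k} else {})"
    using assms by auto
  then show ?thesis
    using pairing_monom[of X Y, where 'k = 'k] finite_subset[OF X(2) finite_W[OF k]] by simp
qed

lemma ideal_Ann_graph_form:
  "ideal (Ann V (graph_form m Fs :: (pvar, 'k::field) mpoly)) (mpoly_ring V)"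
proof -
  let ?R = "mpoly_ring V :: (pvar, 'k) mpoly ring"
  interpret cring ?R by (rule mpoly_ring_cring)
  have mult: "h * g \<in> Ann V (graph_form m Fs)"
    if "g \<in> Ann V (graph_form m Fs)" "h \<in> polys V" for g h :: "(pvar, 'k) mpoly"
  proof -
    have "pairing (h * g) Y = 0" if Y: "finite Y" for Y
      unfolding pairing_mult[OF Y]
    proof (intro sum.neutral ballI)
      fix Z assume "Z \<in> Pow (V - Y)"
      then have "finite (Y \<union> Z)" using Y finite_subset[of Z V] by auto
      then show "lookup h (sqf Z) * pairing g (Y \<union> Z) = 0"
        using \<open>g \<in> Ann V (graph_form m Fs)\<close> by (simp add: Ann_graph_form_iff)
    qed
    then show ?thesis
      using that by (simp add: Ann_graph_form_iff polys_mult_closed)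
  qed
  have neg: "- g = const (- 1) * g" for g :: "(pvar, 'k) mpoly"
    by (rule poly_mapping_eqI) (simp add: lookup_const_mult)
  have c: "const (- 1) \<in> (polys V :: (pvar, 'k) mpoly set)"
    by (simp add: const_def polys_def monomials_def)
  have zero: "0 \<in> Ann V (graph_form m Fs :: (pvar, 'k) mpoly)"
    by (simp add: Ann_graph_form_iff polys_def pairing_def)
  have inv: "a_inv ?R g = - g" if "g \<in> polys V" for g
    by (rule minus_equality) (use that polys_mult_closed[OF c that] in \<open>simp_all add: mpoly_ring_def flip: neg\<close>)
  show ?thesis
  proof (rule idealI)
    show "ring ?R" by (rule ring_axioms)
    show "subgroup (Ann V (graph_form m Fs)) (add_monoid ?R)"
    proof (rule group.subgroupI)
      show "group (add_monoid ?R)" by (rule a_group)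
      show "Ann V (graph_form m Fs :: (pvar, 'k) mpoly) \<subseteq> carrier (add_monoid ?R)"
        by (auto simp: Ann_def mpoly_ring_def)
      show "Ann V (graph_form m Fs :: (pvar, 'k) mpoly) \<noteq> {}"
        using zero by blast
    next
      fix g :: "(pvar, 'k) mpoly" assume g: "g \<in> Ann V (graph_form m Fs)"
      have "inv\<^bsub>add_monoid ?R\<^esub> g = - g"
        using g inv[of g] by (simp add: a_inv_def Ann_def)
      then show "inv\<^bsub>add_monoid ?R\<^esub> g \<in> Ann V (graph_form m Fs)"
        using mult[OF g c] by (simp add: neg[of g])
    next
      fix g h :: "(pvar, 'k) mpoly"
      assume "g \<in> Ann V (graph_form m Fs)" "h \<in> Ann V (graph_form m Fs)"
      then show "g \<otimes>\<^bsub>add_monoid ?R\<^esub> h \<in> Ann V (graph_form m Fs)"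
        by (simp add: mpoly_ring_def Ann_graph_form_iff polys_add_closed pairing_add)
    qed
  qed (use mult in \<open>auto simp: mpoly_ring_def mult.commute\<close>)
qed

end

section \<open>Failure of the weak Lefschetz property\<close>

text \<open>Gaussian elimination: a zero column is dropped, any other column is removed together
  with a pivot row.\<close>

lemma exists_left_kernel:
  fixes M :: "'b \<Rightarrow> 'a \<Rightarrow> 'k::field"
  assumes "finite A" "finite B" "card A < card B"
  shows "\<exists>c. (\<exists>b\<in>B. c b \<noteq> 0) \<and> (\<forall>a\<in>A. (\<Sum>b\<in>B. c b * M b a) = 0)"
  using assms
proof (induction A arbitrary: B M)
  case empty
  then show ?case by (intro exI[of _ "\<lambda>_. 1"]) (auto simp: card_gt_0_iff)
next
  case (insert a A)
  show ?case
  proof (cases "\<forall>b\<in>B. M b a = 0")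
    case True
    obtain c where "\<exists>b\<in>B. c b \<noteq> 0" "\<forall>a\<in>A. (\<Sum>b\<in>B. c b * M b a) = 0"
      using insert.IH[of B M] insert.prems insert.hyps by auto
    then show ?thesis using True by (intro exI[of _ c]) auto
  next
    case False
    then obtain b0 where b0: "b0 \<in> B" "M b0 a \<noteq> 0" by blast
    define B' where "B' = B - {b0}"
    \<comment> \<open>The rows after clearing column \<open>a\<close> with the pivot
      \<open>M b0 a\<close>.\<close>
    define M' where "M' b a' = M b a' - M b a / M b0 a * M b0 a'" for b a'
    have "card A < card B'" "finite B'"
      using insert.prems insert.hyps b0 by (auto simp: B'_def)
    then obtain c where c: "\<exists>b\<in>B'. c b \<noteq> 0" "\<forall>a'\<in>A. (\<Sum>b\<in>B'. c b * M' b a') = 0"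
      using insert.IH[of B' M'] by blast
    \<comment> \<open>The weight of the pivot row is chosen so that \<open>d\<close> combines the
      rows of \<open>M\<close> to the same result as \<open>c\<close> those of
      \<open>M'\<close>.\<close>
    define d where "d b = (if b = b0 then - (\<Sum>b\<in>B'. c b * (M b a / M b0 a)) else c b)" for b
    have "(\<Sum>b\<in>B. d b * M b a') = (\<Sum>b\<in>B'. c b * M' b a')" for a'
    proof -
      have "(\<Sum>b\<in>B. d b * M b a') = d b0 * M b0 a' + (\<Sum>b\<in>B'. d b * M b a')"
        unfolding B'_def using insert.prems b0 by (simp add: sum.remove)
      also have "(\<Sum>b\<in>B'. d b * M b a') = (\<Sum>b\<in>B'. c b * M b a')"
        by (rule sum.cong) (auto simp: d_def B'_def)
      finally show ?thesis
        by (simp add: d_def M'_def algebra_simps sum_subtractf sum_distrib_left)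
    qed
    moreover have "M' b a = 0" for b
      using b0 by (simp add: M'_def)
    moreover have "\<exists>b\<in>B. d b \<noteq> 0"
      using c(1) by (auto simp: d_def B'_def)
    ultimately show ?thesis
      using c(2) by (intro exI[of _ d]) auto
  qed
qed

section \<open>Faces and multiplication by a linear form\<close>

context facet_form
begin

definition faces :: "nat \<Rightarrow> nat set set"
  where "faces j = {\<sigma>. card \<sigma> = j \<and> (\<exists>k\<in>{1..m}. \<sigma> \<subseteq> Fs k)}"

lemma faces_subset: "\<sigma> \<in> faces j \<Longrightarrow> \<sigma> \<subseteq> {1..N}"
  using facet_subset by (fastforce simp: faces_def)

lemma finite_face: "\<sigma> \<in> faces j \<Longrightarrow> finite \<sigma>"
  using faces_subset finite_subset by blast

lemma finite_faces: "finite (faces j)"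
  by (rule finite_subset[of _ "Pow {1..N}"]) (use faces_subset in auto)

lemma face_remove: "\<sigma> \<in> faces (Suc j) \<Longrightarrow> v \<in> \<sigma> \<Longrightarrow> \<sigma> - {v} \<in> faces j"
  using finite_face[of \<sigma>] by (auto simp: faces_def)

text \<open>This makes the face monomials \<open>u_\<sigma>\<close> linearly independent modulo the
  annihilator.\<close>

lemma lookup_face_Ann:
  assumes g: "g \<in> Ann V (graph_form m Fs :: (pvar, 'k::field) mpoly)" and \<sigma>: "\<sigma> \<in> faces j"
  shows "lookup g (sqf (Uvar ` \<sigma>)) = 0"
proof -
  obtain k where k: "k \<in> {1..m}" "\<sigma> \<subseteq> Fs k" using \<sigma> by (auto simp: faces_def)
  \<comment> \<open>This set contains \<open>Xvar k\<close>, so the pairing at it has a single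
    summand.\<close>
  let ?Y = "W k - Uvar ` \<sigma>"
  have "{l. l \<in> {1..m} \<and> ?Y \<subseteq> W l} = {k}"
    using k by (auto simp: W_def)
  moreover have "W k - ?Y = Uvar ` \<sigma>" using k by (auto simp: W_def)
  ultimately have "pairing g ?Y = lookup g (sqf (Uvar ` \<sigma>))"
    by (simp add: pairing_def)
  then show ?thesis using g k finite_W by (simp add: Ann_graph_form_iff)
qed

text \<open>The rows are indexed by the faces with \<open>j + 1\<close> vertices, the columns by those with \<open>j\<close>. The
  transpose describes the multiplication between the dual graded pieces in \<open>x\<close>-degree \<open>1\<close>.\<close>

definition face_matrix :: "(pvar, 'k::field) mpoly \<Rightarrow> nat set \<Rightarrow> nat set \<Rightarrow> 'k"
  where "face_matrix l \<sigma> \<tau> =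
    (\<Sum>v\<in>\<sigma>. if \<sigma> - {v} = \<tau> then lookup l (Poly_Mapping.single (Uvar v) 1) else 0)"

lemma homogeneous_sqf_0:
  assumes "homogeneous d p" "finite X" "card X \<noteq> d"
  shows "lookup p (sqf X) = 0"
  using assms mon_degree_sqf[of X] by (metis homogeneous_def in_keys_iff)

lemma sum_linear_form:
  fixes l :: "(pvar, 'k::field) mpoly"
  assumes l: "homogeneous 1 l" and X: "finite X"
  shows "(\<Sum>Z\<in>Pow X. lookup l (sqf Z) * f Z) =
    (\<Sum>v\<in>X. lookup l (Poly_Mapping.single v 1) * f {v})"
proof -
  have "(\<Sum>Z\<in>Pow X. lookup l (sqf Z) * f Z) = (\<Sum>Z\<in>(\<lambda>v. {v}) ` X. lookup l (sqf Z) * f Z)"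
  proof (rule sum.mono_neutral_right)
    show "\<forall>Z\<in>Pow X - (\<lambda>v. {v}) ` X. lookup l (sqf Z) * f Z = 0"
    proof
      fix Z assume Z: "Z \<in> Pow X - (\<lambda>v. {v}) ` X"
      then have "card Z \<noteq> 1" by (metis DiffE PowD card_1_singletonE image_eqI insert_subset)
      moreover have "finite Z" using Z X by (meson DiffE PowD finite_subset)
      ultimately show "lookup l (sqf Z) * f Z = 0"
        using homogeneous_sqf_0[OF l] by simp
    qed
  qed (use X in auto)
  also have "\<dots> = (\<Sum>v\<in>X. lookup l (Poly_Mapping.single v 1) * f {v})"
    by (subst sum.reindex) auto
  finally show ?thesis .
qed

text \<open>Only factorisations of \<open>u_\<sigma>\<close> into a variable and a smaller face
  count, so the terms of \<open>l\<close> and \<open>q\<close> involving an \<open>x\<close> and the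
  nonface terms of \<open>q\<close> drop out.\<close>

lemma lookup_face_linear_mult:
  fixes l q :: "(pvar, 'k::field) mpoly"
  assumes l: "homogeneous 1 l" and \<sigma>: "\<sigma> \<in> faces (Suc j)"
  shows "lookup (l * q) (sqf (Uvar ` \<sigma>)) =
    (\<Sum>\<tau>\<in>faces j. face_matrix l \<sigma> \<tau> * lookup q (sqf (Uvar ` \<tau>)))"
proof -
  have [simp]: "finite \<sigma>" using \<sigma> by (rule finite_face)
  let ?a = "\<lambda>v. lookup l (Poly_Mapping.single (Uvar v) 1)"
  have "lookup (l * q) (sqf (Uvar ` \<sigma>)) =
      (\<Sum>v\<in>Uvar ` \<sigma>. lookup l (Poly_Mapping.single v 1) * lookup q (sqf (Uvar ` \<sigma> - {v})))"
    by (simp add: lookup_mult_sqf sum_linear_form[OF l])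
  also have "\<dots> = (\<Sum>v\<in>\<sigma>. ?a v * lookup q (sqf (Uvar ` \<sigma> - {Uvar v})))"
    by (subst sum.reindex) (auto simp: inj_on_def)
  also have "\<dots> = (\<Sum>v\<in>\<sigma>. ?a v * lookup q (sqf (Uvar ` (\<sigma> - {v}))))"
    by (intro sum.cong refl arg_cong2[where f = "(*)"] arg_cong[where f = "\<lambda>X. lookup q (sqf X)"]) auto
  also have "\<dots> = (\<Sum>v\<in>\<sigma>. \<Sum>\<tau>\<in>faces j. if \<sigma> - {v} = \<tau> then ?a v * lookup q (sqf (Uvar ` \<tau>)) else 0)"
    by (intro sum.cong refl) (use face_remove[OF \<sigma>] finite_faces in simp)
  also have "\<dots> = (\<Sum>\<tau>\<in>faces j. \<Sum>v\<in>\<sigma>. if \<sigma> - {v} = \<tau> then ?a v * lookup q (sqf (Uvar ` \<tau>)) else 0)"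
    by (rule sum.swap)
  also have "\<dots> = (\<Sum>\<tau>\<in>faces j. face_matrix l \<sigma> \<tau> * lookup q (sqf (Uvar ` \<tau>)))"
    unfolding face_matrix_def sum_distrib_right by (intro sum.cong refl) simp
  finally show ?thesis .
qed

text \<open>A left kernel vector \<open>c\<close> of \<open>face_matrix\<close> is a functional on
  face coefficients. It vanishes on the annihilator and on all \<open>l * q\<close>, but not on the
  monomial of a face with nonzero weight.\<close>

lemma not_surjective_mult:
  fixes l :: "(pvar, 'k::field) mpoly"
  assumes l: "homogeneous 1 l" and card: "card (faces j) < card (faces (Suc j))"
  obtains p where "p \<in> polys V" "homogeneous (Suc j) p"
    "\<And>q. p - l * q \<notin> Ann V (graph_form m Fs)"
proof -
  obtain c where c: "\<exists>\<sigma>\<in>faces (Suc j). c \<sigma> \<noteq> 0"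
    "\<forall>\<tau>\<in>faces j. (\<Sum>\<sigma>\<in>faces (Suc j). c \<sigma> * face_matrix l \<sigma> \<tau>) = 0"
    using exists_left_kernel[OF finite_faces finite_faces card, of "face_matrix l"] by blast
  then obtain \<sigma>0 where \<sigma>0: "\<sigma>0 \<in> faces (Suc j)" "c \<sigma>0 \<noteq> 0" by blast
  define p :: "(pvar, 'k) mpoly" where "p = monom (sqf (Uvar ` \<sigma>0))"
  have fin: "finite \<sigma>" if "\<sigma> \<in> faces (Suc j)" for \<sigma> using finite_face that .
  show ?thesis
  proof
    show "p \<in> polys V"
      using faces_subset[OF \<sigma>0(1)] fin[OF \<sigma>0(1)]
      by (auto simp: p_def polys_def monom_def monomials_def xu_vars_def)
    show "homogeneous (Suc j) p"
      using \<sigma>0(1) fin[OF \<sigma>0(1)]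
      by (auto simp: p_def homogeneous_def monom_def mon_degree_sqf faces_def card_image inj_on_def)
    fix q
    have "(\<Sum>\<sigma>\<in>faces (Suc j). c \<sigma> * lookup (l * q) (sqf (Uvar ` \<sigma>))) =
        (\<Sum>\<sigma>\<in>faces (Suc j). \<Sum>\<tau>\<in>faces j. c \<sigma> * face_matrix l \<sigma> \<tau> * lookup q (sqf (Uvar ` \<tau>)))"
      by (intro sum.cong refl) (simp add: lookup_face_linear_mult[OF l] sum_distrib_left mult.assoc)
    also have "\<dots> = (\<Sum>\<tau>\<in>faces j. (\<Sum>\<sigma>\<in>faces (Suc j). c \<sigma> * face_matrix l \<sigma> \<tau>) * lookup q (sqf (Uvar ` \<tau>)))"
      unfolding sum_distrib_right by (rule sum.swap)
    also have "\<dots> = 0" using c(2) by simp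
    finally have 0: "(\<Sum>\<sigma>\<in>faces (Suc j). c \<sigma> * lookup (l * q) (sqf (Uvar ` \<sigma>))) = 0" .
    show "p - l * q \<notin> Ann V (graph_form m Fs)"
    proof
      assume "p - l * q \<in> Ann V (graph_form m Fs)"
      then have "lookup (l * q) (sqf (Uvar ` \<sigma>)) = lookup p (sqf (Uvar ` \<sigma>))"
        if "\<sigma> \<in> faces (Suc j)" for \<sigma>
        using lookup_face_Ann[OF _ that] by (fastforce simp: lookup_minus)
      also have "\<dots> \<sigma> = (if \<sigma> = \<sigma>0 then 1 else 0)" if "\<sigma> \<in> faces (Suc j)" for \<sigma>
        using fin[OF that] fin[OF \<sigma>0(1)]
        by (auto simp: p_def lookup_monom sqf_inject inj_image_eq_iff inj_def)
      finally have "(\<Sum>\<sigma>\<in>faces (Suc j). c \<sigma> * lookup (l * q) (sqf (Uvar ` \<sigma>))) =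
          (\<Sum>\<sigma>\<in>faces (Suc j). if \<sigma> = \<sigma>0 then c \<sigma> else 0)"
        by (intro sum.cong refl) simp
      with 0 \<sigma>0 finite_faces show False by simp
    qed
  qed
qed

text \<open>Dually, the kernel vector is realised as an element: \<open>q\<close> acts on the form
  with result the combination of the \<open>u_\<sigma>\<close> with weights
  \<open>c \<sigma>\<close>, and letting \<open>l\<close> act on this gives the kernel equations as
  coefficients.\<close>

lemma not_injective_mult:
  fixes l :: "(pvar, 'k::field) mpoly"
  assumes l: "l \<in> polys V" "homogeneous 1 l" and card: "card (faces j) < card (faces (Suc j))"
    and pure: "\<And>k. k \<in> {1..m} \<Longrightarrow> card (Fs k) = d" and i: "i + j = d"
  obtains q where "q \<in> polys V" "homogeneous i q" "q \<notin> Ann V (graph_form m Fs)"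
    "l * q \<in> Ann V (graph_form m Fs)"
proof -
  obtain c where c: "\<exists>\<sigma>\<in>faces (Suc j). c \<sigma> \<noteq> 0"
    "\<forall>\<tau>\<in>faces j. (\<Sum>\<sigma>\<in>faces (Suc j). c \<sigma> * face_matrix l \<sigma> \<tau>) = 0"
    using exists_left_kernel[OF finite_faces finite_faces card, of "face_matrix l"] by blast
  then obtain \<sigma>0 where \<sigma>0: "\<sigma>0 \<in> faces (Suc j)" "c \<sigma>0 \<noteq> 0" by blast
  have "\<exists>k\<in>{1..m}. \<sigma> \<subseteq> Fs k" if "\<sigma> \<in> faces (Suc j)" for \<sigma>
    using that by (auto simp: faces_def)
  then obtain k where k: "\<And>\<sigma>. \<sigma> \<in> faces (Suc j) \<Longrightarrow> k \<sigma> \<in> {1..m} \<and> \<sigma> \<subseteq> Fs (k \<sigma>)"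
    by metis
  \<comment> \<open>The complement contains \<open>Xvar (k \<sigma>)\<close>, so its monomial sends
    the form to exactly \<open>u_\<sigma>\<close>; by purity its degree is
    \<open>(d + 1) - (j + 1) = i\<close>.\<close>
  define X where "X \<sigma> = W (k \<sigma>) - Uvar ` \<sigma>" for \<sigma>
  define q :: "(pvar, 'k) mpoly" where "q = (\<Sum>\<sigma>\<in>faces (Suc j). const (c \<sigma>) * monom (sqf (X \<sigma>)))"
  have X: "finite (X \<sigma>)" "X \<sigma> \<subseteq> V" "card (X \<sigma>) = i" "W (k \<sigma>) - X \<sigma> = Uvar ` \<sigma>"
    if "\<sigma> \<in> faces (Suc j)" for \<sigma>
  proof -
    have *: "Uvar ` \<sigma> \<subseteq> W (k \<sigma>)" using k[OF that] by (auto simp: W_def)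
    have "card (W (k \<sigma>)) = Suc d"
      using k[OF that] pure[of "k \<sigma>"] finite_facet[of "k \<sigma>"]
      unfolding W_def by (subst card_insert_disjoint) (auto simp: card_image inj_on_def)
    moreover have "card (Uvar ` \<sigma>) = Suc j"
      using that by (auto simp: faces_def card_image inj_on_def)
    ultimately show "card (X \<sigma>) = i"
      using * i that unfolding X_def by (subst card_Diff_subset) (auto simp: finite_face)
    show "finite (X \<sigma>)" "X \<sigma> \<subseteq> V" using k[OF that] finite_W W_subset by (auto simp: X_def)
    show "W (k \<sigma>) - X \<sigma> = Uvar ` \<sigma>" using * by (auto simp: X_def)
  qed
  have keys: "\<exists>\<sigma>\<in>faces (Suc j). t = sqf (X \<sigma>)" if "t \<in> keys q" for t
  proof (rule ccontr)
    assume "\<not> ?thesis"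
    then have "lookup q t = 0"
      by (auto simp: q_def lookup_sum lookup_const_mult lookup_monom intro!: sum.neutral)
    with that show False by (simp add: in_keys_iff)
  qed
  have pair: "pairing q Y = (\<Sum>\<sigma>\<in>faces (Suc j). if Y = Uvar ` \<sigma> then c \<sigma> else 0)" for Y
  proof -
    have "pairing (monom (sqf (X \<sigma>)) :: (pvar, 'k) mpoly) Y = (if Y = Uvar ` \<sigma> then 1 else 0)"
      if "\<sigma> \<in> faces (Suc j)" for \<sigma>
    proof -
      have "Xvar (k \<sigma>) \<in> X \<sigma>" "X \<sigma> \<subseteq> W (k \<sigma>)" by (auto simp: X_def)
      then show ?thesis
        using pairing_monom_Xvar[of "k \<sigma>" "X \<sigma>" Y, where 'k = 'k] k[OF that] X(4)[OF that] by simp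
    qed
    then show ?thesis
      unfolding q_def pairing_sum pairing_const_mult by (intro sum.cong refl) simp
  qed
  have pair_face: "pairing q (Uvar ` \<sigma>) = (if \<sigma> \<in> faces (Suc j) then c \<sigma> else 0)" for \<sigma>
    unfolding pair using finite_faces by (simp add: inj_image_eq_iff inj_def)
  have q: "q \<in> polys V"
    unfolding polys_def using keys X by (fastforce simp: monomials_def)
  show ?thesis
  proof
    show "q \<in> polys V" by fact
    show "homogeneous i q"
      unfolding homogeneous_def using keys X by (fastforce simp: mon_degree_sqf)
    show "q \<notin> Ann V (graph_form m Fs)"
      using pair_face[of \<sigma>0] \<sigma>0 finite_face[OF \<sigma>0(1)] by (metis Ann_graph_form_iff finite_imageI)
    have "pairing (l * q) Y = 0" if Y: "finite Y" for Y
    proof -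
      have 1: "pairing (l * q) Y =
          (\<Sum>v\<in>V - Y. lookup l (Poly_Mapping.single v 1) * pairing q (Y \<union> {v}))"
        using Y by (simp add: pairing_mult sum_linear_form[OF l(2)])
      show ?thesis
      proof (cases "\<exists>\<tau>\<in>faces j. Y = Uvar ` \<tau>")
        case True
        then obtain \<tau> where \<tau>: "\<tau> \<in> faces j" "Y = Uvar ` \<tau>" by blast
        have "pairing (l * q) Y = (\<Sum>v\<in>V - Y. \<Sum>\<sigma>\<in>faces (Suc j).
            if Y \<union> {v} = Uvar ` \<sigma> then c \<sigma> * lookup l (Poly_Mapping.single v 1) else 0)"
          unfolding 1 pair sum_distrib_left by (intro sum.cong refl) simp
        also have "\<dots> = (\<Sum>\<sigma>\<in>faces (Suc j). \<Sum>v\<in>V - Y.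
            if Y \<union> {v} = Uvar ` \<sigma> then c \<sigma> * lookup l (Poly_Mapping.single v 1) else 0)"
          by (rule sum.swap)
        also have "\<dots> = (\<Sum>\<sigma>\<in>faces (Suc j). c \<sigma> * face_matrix l \<sigma> \<tau>)"
        proof (intro sum.cong refl)
          fix \<sigma> assume \<sigma>: "\<sigma> \<in> faces (Suc j)"
          have "(\<Sum>v\<in>V - Y. if Y \<union> {v} = Uvar ` \<sigma> then c \<sigma> * lookup l (Poly_Mapping.single v 1) else 0)
              = (\<Sum>v\<in>Uvar ` {v\<in>\<sigma>. \<sigma> - {v} = \<tau>}. c \<sigma> * lookup l (Poly_Mapping.single v 1))"
          proof (subst sum.inter_filter[symmetric])
            \<comment> \<open>Adding \<open>v\<close> to the set of \<open>\<tau>\<close> gives that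
              of \<open>\<sigma>\<close> exactly when \<open>v\<close> is the vertex whose removal
              is recorded in \<open>face_matrix\<close>.\<close>
            have "{v \<in> V - Y. Y \<union> {v} = Uvar ` \<sigma>} = Uvar ` {v\<in>\<sigma>. \<sigma> - {v} = \<tau>}"
            proof -
              have "Uvar ` \<tau> \<union> {Uvar w} = Uvar ` \<sigma> \<longleftrightarrow> insert w \<tau> = \<sigma>" for w
                using inj_image_eq_iff[of Uvar "insert w \<tau>" \<sigma>] by (simp add: inj_def)
              then show ?thesis
                unfolding \<tau>(2) using faces_subset[OF \<sigma>] by (auto simp: xu_vars_def)
            qed
            then show "(\<Sum>v\<in>{v \<in> V - Y. Y \<union> {v} = Uvar ` \<sigma>}. c \<sigma> * lookup l (Poly_Mapping.single v 1))
              = (\<Sum>v\<in>Uvar ` {v\<in>\<sigma>. \<sigma> - {v} = \<tau>}. c \<sigma> * lookup l (Poly_Mapping.single v 1))"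
              by simp
          qed simp
          also have "\<dots> = (\<Sum>v\<in>{v\<in>\<sigma>. \<sigma> - {v} = \<tau>}. c \<sigma> * lookup l (Poly_Mapping.single (Uvar v) 1))"
            by (subst sum.reindex) (auto simp: inj_on_def)
          also have "\<dots> = c \<sigma> * face_matrix l \<sigma> \<tau>"
            unfolding face_matrix_def sum_distrib_left[symmetric]
            by (simp only: sum.inter_filter[OF finite_face[OF \<sigma>]])
          finally show "(\<Sum>v\<in>V - Y. if Y \<union> {v} = Uvar ` \<sigma> then c \<sigma> * lookup l (Poly_Mapping.single v 1) else 0)
              = c \<sigma> * face_matrix l \<sigma> \<tau>" .
        qed
        finally show ?thesis using c(2) \<tau>(1) by simp
      next
        case False
        \<comment> \<open>Removing a vertex from a face with \<open>j + 1\<close> vertices leaves a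
          face with \<open>j\<close>, so a \<open>Y\<close> of any other kind cannot be completed to
          one.\<close>
        have "pairing q (Y \<union> {v}) = 0" if v: "v \<in> V - Y" for v
        proof (rule ccontr)
          assume "pairing q (Y \<union> {v}) \<noteq> 0"
          then obtain \<sigma> where \<sigma>: "\<sigma> \<in> faces (Suc j)" "Y \<union> {v} = Uvar ` \<sigma>"
            unfolding pair by (auto elim!: sum.not_neutral_contains_not_neutral split: if_splits)
          then obtain w where w: "w \<in> \<sigma>" "v = Uvar w" by blast
          then have "Y = Uvar ` \<sigma> - {Uvar w}" using \<sigma> v by blast
          also have "\<dots> = Uvar ` (\<sigma> - {w})" by auto
          finally have "Y = Uvar ` (\<sigma> - {w})" .
          with False face_remove[OF \<sigma>(1) w(1)] show False by blast
        qed
        then show ?thesis unfolding 1 by (simp add: sum.neutral)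
      qed
    qed
    then show "l * q \<in> Ann V (graph_form m Fs)"
      using l q by (simp add: Ann_graph_form_iff polys_mult_closed)
  qed
qed

text \<open>Both obstructions meet in degree \<open>i\<close>: growth of the face numbers at
  \<open>i\<close> blocks surjectivity onto degree \<open>i + 1\<close>, growth at the dual index
  \<open>j\<close> blocks injectivity.\<close>

theorem not_weak_Lefschetz_graph_form:
  assumes pure: "\<And>k. k \<in> {1..m} \<Longrightarrow> card (Fs k) = d" and i: "i + j = d"
    and card: "card (faces i) < card (faces (Suc i))" "card (faces j) < card (faces (Suc j))"
  shows "\<not> weak_Lefschetz (macaulay_algebra V (graph_form m Fs :: (pvar, 'k::field) mpoly))
             (graded_piece V (Ann V (graph_form m Fs :: (pvar, 'k) mpoly)))"
proof
  let ?R = "mpoly_ring V :: (pvar, 'k) mpoly ring"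
  let ?I = "Ann V (graph_form m Fs :: (pvar, 'k) mpoly)"
  let ?cls = "\<lambda>p. ?I +>\<^bsub>?R\<^esub> p"
  interpret ideal ?I ?R by (rule ideal_Ann_graph_form)
  have [simp]: "carrier ?R = polys V" "\<And>p q. p \<otimes>\<^bsub>?R\<^esub> q = p * q" "\<zero>\<^bsub>?R\<^esub> = 0" "\<And>p q. p \<oplus>\<^bsub>?R\<^esub> q = p + q"
    by (simp_all add: mpoly_ring_def)
  have polys_diff: "p - q \<in> polys V" if "p \<in> polys V" "q \<in> polys V" for p q :: "(pvar, 'k) mpoly"
    using that keys_diff[of p q] unfolding polys_def by blast
  have coset_eq: "?cls p = ?cls q \<longleftrightarrow> p - q \<in> ?I" if "p \<in> polys V" "q \<in> polys V" for p q
  proof -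
    have "?cls p = {h + p |h. h \<in> ?I}" for p
      by (auto simp: a_r_coset_def')
    then have "?cls p = ?cls q \<longleftrightarrow> p \<in> ?cls q"
      using a_repr_independence'[of p q] a_rcos_self[of p] that by auto
    also have "\<dots> \<longleftrightarrow> p - q \<in> ?I"
      by (auto simp: a_r_coset_def' intro!: bexI[of _ "p - q"])
    finally show ?thesis .
  qed
  have mult: "?cls p \<otimes>\<^bsub>macaulay_algebra V (graph_form m Fs)\<^esub> ?cls q = ?cls (p * q)"
    if "p \<in> polys V" "q \<in> polys V" for p q
    using rcoset_mult_add[of p q] that by (simp add: macaulay_algebra_def FactRing_def)
  assume "weak_Lefschetz (macaulay_algebra V (graph_form m Fs :: (pvar, 'k) mpoly)) (graded_piece V ?I)"
  then obtain l where l: "l \<in> polys V" "homogeneous 1 l"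
    and max_rank: "inj_on (\<lambda>a. ?cls l \<otimes>\<^bsub>macaulay_algebra V (graph_form m Fs)\<^esub> a) (graded_piece V ?I i) \<or>
      (\<lambda>a. ?cls l \<otimes>\<^bsub>macaulay_algebra V (graph_form m Fs)\<^esub> a) ` graded_piece V ?I i = graded_piece V ?I (i + 1)"
    unfolding weak_Lefschetz_def graded_piece_def by auto
  from max_rank show False
  proof
    assume inj: "inj_on (\<lambda>a. ?cls l \<otimes>\<^bsub>macaulay_algebra V (graph_form m Fs)\<^esub> a) (graded_piece V ?I i)"
    obtain q where q: "q \<in> polys V" "homogeneous i q" "q \<notin> ?I" "l * q \<in> ?I"
      using not_injective_mult[OF l card(2) pure i] by blast
    have 0: "0 \<in> polys V" "homogeneous i (0 :: (pvar, 'k) mpoly)"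
      by (auto simp: polys_def homogeneous_def)
    have "?cls (l * q) = ?cls (l * 0)"
      by (subst coset_eq) (use l q 0 polys_mult_closed in auto)
    then have "?cls l \<otimes>\<^bsub>macaulay_algebra V (graph_form m Fs)\<^esub> ?cls q =
        ?cls l \<otimes>\<^bsub>macaulay_algebra V (graph_form m Fs)\<^esub> ?cls 0"
      using mult[OF l(1) q(1)] mult[OF l(1) 0(1)] by simp
    then have "?cls q = ?cls 0"
      by (rule inj_onD[OF inj]) (use q 0 in \<open>auto simp: graded_piece_def\<close>)
    then show False using coset_eq[of q 0] q 0 by simp
  next
    assume surj: "(\<lambda>a. ?cls l \<otimes>\<^bsub>macaulay_algebra V (graph_form m Fs)\<^esub> a) ` graded_piece V ?I i = graded_piece V ?I (i + 1)"
    obtain p where p: "p \<in> polys V" "homogeneous (Suc i) p" "\<And>q. p - l * q \<notin> ?I"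
      using not_surjective_mult[OF l(2) card(1)] by blast
    then have "?cls p \<in> graded_piece V ?I (i + 1)" by (auto simp: graded_piece_def)
    then obtain q where "q \<in> polys V" "?cls p = ?cls (l * q)"
      unfolding surj[symmetric] using mult l by (auto simp: graded_piece_def)
    then show False using p coset_eq[of p "l * q"] l polys_mult_closed by blast
  qed
qed

end

section \<open>A quadratic Groebner basis\<close>

instantiation pvar :: linorder
begin

text \<open>The variables \<open>u\<^sub>1, u\<^sub>2, \<dots>\<close> come first, so that the lexicographic order on monomials
  weighs their exponents most.\<close>

fun less_eq_pvar :: "pvar \<Rightarrow> pvar \<Rightarrow> bool" where
  "Uvar i \<le> Uvar j \<longleftrightarrow> i \<le> j"
| "Uvar i \<le> Xvar j \<longleftrightarrow> True"
| "Xvar i \<le> Uvar j \<longleftrightarrow> False"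
| "Xvar i \<le> Xvar j \<longleftrightarrow> i \<le> j"

definition less_pvar :: "pvar \<Rightarrow> pvar \<Rightarrow> bool"
  where "less_pvar v w \<longleftrightarrow> v \<le> w \<and> \<not> w \<le> v"

instance
proof
  fix u v w :: pvar
  show "u < v \<longleftrightarrow> u \<le> v \<and> \<not> v \<le> u" by (rule less_pvar_def)
  show "u \<le> u" by (cases u) auto
  show "u \<le> v \<Longrightarrow> v \<le> w \<Longrightarrow> u \<le> w" by (cases u; cases v; cases w) auto
  show "u \<le> v \<Longrightarrow> v \<le> u \<Longrightarrow> u = v" by (cases u; cases v) auto
  show "u \<le> v \<or> v \<le> u" by (cases u; cases v) auto
qed

end

section \<open>The lexicographic order and a divisibility criterion for Groebner bases\<close>

lemma less_Uvar_iff: "v < Uvar i \<longleftrightarrow> (\<exists>j<i. v = Uvar j)"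
  by (cases v) (auto simp: less_pvar_def)

text \<open>Here \<open>v\<close> is the first variable in which the exponents differ, and they are
  0 and 1 there.\<close>

lemma sqf_less_sqf:
  assumes "finite X" "finite Y" "v \<in> Y - X" "\<And>w. w < v \<Longrightarrow> w \<in> X \<longleftrightarrow> w \<in> Y"
  shows "sqf X < sqf Y"
  unfolding less_poly_mapping.rep_eq less_fun_def
  by (rule exI[of _ v]) (use assms in \<open>simp add: lookup_sqf\<close>)

text \<open>The order on finitely supported maps is decided at the smallest variable where the
  exponents differ.\<close>

definition lex_order :: "'v::linorder set \<Rightarrow> 'v monomial rel"
  where "lex_order V = {(s, t). s \<in> monomials V \<and> t \<in> monomials V \<and> s \<le> t}"

lemma monomials_add: "s \<in> monomials V \<Longrightarrow> t \<in> monomials V \<Longrightarrow> s + t \<in> monomials V"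
  using keys_add[of s t] by (auto simp: monomials_def)

lemma monomial_order_lex_order: "monomial_order V (lex_order V)"
  unfolding monomial_order_def
proof (intro conjI ballI allI impI)
  show "linear_order_on (monomials V) (lex_order V)"
    by (auto simp: order_on_defs lex_order_def refl_on_def trans_def antisym_def total_on_def)
next
  fix t :: "'a monomial" assume "t \<in> monomials V"
  moreover have "\<not> t < 0" by (simp add: less_poly_mapping.rep_eq less_fun_def)
  ultimately show "(0, t) \<in> lex_order V"
    by (simp add: lex_order_def monomials_def)
next
  fix s t u :: "'a monomial"
  assume "(s, t) \<in> lex_order V" "u \<in> monomials V"
  then show "(s + u, t + u) \<in> lex_order V"
    by (simp add: lex_order_def monomials_add add_right_mono)
qed

lemma leading_monomial_lex_orderI:
  assumes "p \<in> polys V" "t \<in> keys p" "\<And>s. s \<in> keys p \<Longrightarrow> s \<le> t"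
  shows "leading_monomial (lex_order V) p = t"
  unfolding leading_monomial_def
  by (rule the_equality) (use assms in \<open>auto simp: lex_order_def polys_def intro: antisym\<close>)

lemma leading_monomial_lex_order:
  assumes "p \<in> polys V" "p \<noteq> 0"
  shows "leading_monomial (lex_order V) p \<in> keys p"
    "s \<in> keys p \<Longrightarrow> s \<le> leading_monomial (lex_order V) p"
proof -
  have "leading_monomial (lex_order V) p = Max (keys p)"
    by (rule leading_monomial_lex_orderI) (use assms in auto)
  then show "leading_monomial (lex_order V) p \<in> keys p"
    "s \<in> keys p \<Longrightarrow> s \<le> leading_monomial (lex_order V) p"
    using assms by auto
qed

lemma leading_monomial_lex_order_monom:
  "t \<in> monomials V \<Longrightarrow> leading_monomial (lex_order V) (monom t :: ('v::linorder, 'k::field) mpoly) = t"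
  by (rule leading_monomial_lex_orderI) (auto simp: polys_def monom_def)

text \<open>By divisibility each leading monomial from \<open>I\<close> is a multiple of a generator
  of the initial ideal of \<open>B\<close>; the converse inclusion follows from
  \<open>B \<subseteq> I\<close>.\<close>

lemma groebner_basis_lex_orderI:
  fixes B I :: "('v::linorder, 'k::field) mpoly set"
  assumes I: "I \<subseteq> polys V" and B: "finite B" "B \<subseteq> I - {0}"
    and div: "\<And>f. f \<in> I \<Longrightarrow> f \<noteq> 0 \<Longrightarrow> \<exists>b\<in>B. \<exists>u\<in>monomials V.
      leading_monomial (lex_order V) f = u + leading_monomial (lex_order V) b"
  shows "groebner_basis V (lex_order V) I B"
proof -
  let ?R = "mpoly_ring V :: ('v, 'k) mpoly ring"
  let ?lm = "\<lambda>p :: ('v, 'k) mpoly. monom (leading_monomial (lex_order V) p) :: ('v, 'k) mpoly"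
  interpret cring ?R by (rule mpoly_ring_cring)
  have monom_polys: "monom t \<in> carrier ?R" if "t \<in> monomials V" for t
    using that by (simp add: mpoly_ring_def polys_def monom_def)
  have lm: "?lm p \<in> carrier ?R" if "p \<in> I - {0}" for p
    using leading_monomial_lex_order(1)[of p V] that I by (intro monom_polys) (auto simp: polys_def)
  have sub: "?lm ` (B - {0}) \<subseteq> carrier ?R" "?lm ` (I - {0}) \<subseteq> carrier ?R"
    using lm B by blast+
  have "?lm f \<in> Idl\<^bsub>?R\<^esub> (?lm ` (B - {0}))" if f: "f \<in> I - {0}" for f
  proof -
    obtain b u where b: "b \<in> B" "u \<in> monomials V"
      "leading_monomial (lex_order V) f = u + leading_monomial (lex_order V) b"
      using div f by blast
    have "?lm f = monom u \<otimes>\<^bsub>?R\<^esub> ?lm b"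
      by (simp add: b(3) mpoly_ring_def monom_mult)
    moreover have "?lm b \<in> Idl\<^bsub>?R\<^esub> (?lm ` (B - {0}))"
      using genideal_self[OF sub(1)] b B by blast
    ultimately show ?thesis
      using ideal.I_l_closed[OF genideal_ideal[OF sub(1)]] monom_polys[OF b(2)] by simp
  qed
  then have "Idl\<^bsub>?R\<^esub> (?lm ` (I - {0})) \<subseteq> Idl\<^bsub>?R\<^esub> (?lm ` (B - {0}))"
    by (intro genideal_minimal genideal_ideal sub) blast
  moreover have "Idl\<^bsub>?R\<^esub> (?lm ` (B - {0})) \<subseteq> Idl\<^bsub>?R\<^esub> (?lm ` (I - {0}))"
    by (intro genideal_minimal genideal_ideal sub) (use genideal_self[OF sub(2)] B in blast)
  ultimately show ?thesis
    using B by (auto simp: groebner_basis_def initial_ideal_def)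
qed

section \<open>Maximal independent sets of a whiskered graph\<close>

locale whiskered_form =
  fixes n m :: nat and E :: "nat set set" and Fs :: "nat \<Rightarrow> nat set"
  assumes edges: "E \<subseteq> [{1..n}]\<^bsup>2\<^esup>"
    and facets: "bij_betw Fs {1..m} (max_indep_sets {1..2*n} (whiskering n E))"
begin

definition indeps :: "nat set set"
  where "indeps = {T. T \<subseteq> {1..n} \<and> indep T E}"

definition facet :: "nat set \<Rightarrow> nat set"
  where "facet T = T \<union> (\<lambda>i. i + n) ` ({1..n} - T)"

lemma edge_subset: "{i, j} \<in> E \<Longrightarrow> i \<in> {1..n} \<and> j \<in> {1..n}"
  using edges by (auto simp: nsets_def)

text \<open>The edges of \<open>H\<close> lie inside \<open>{1..n}\<close>, so only whiskers
  constrain the vertices \<open>i + n\<close>.\<close>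

lemma indep_whiskering_iff:
  "indep S (whiskering n E) \<longleftrightarrow> indep (S \<inter> {1..n}) E \<and> (\<forall>i\<in>{1..n}. \<not> (i \<in> S \<and> i + n \<in> S))"
proof (intro iffI conjI ballI notI)
  fix i assume "indep S (whiskering n E)" "i \<in> {1..n}" "i \<in> S \<and> i + n \<in> S"
  then show False by (force simp: indep_def whiskering_def)
next
  assume *: "indep (S \<inter> {1..n}) E \<and> (\<forall>i\<in>{1..n}. \<not> (i \<in> S \<and> i + n \<in> S))"
  show "indep S (whiskering n E)"
    unfolding indep_def
  proof (intro ballI impI notI)
    fix v w assume vw: "v \<in> S" "w \<in> S" "v \<noteq> w" "{v, w} \<in> whiskering n E"
    then consider "{v, w} \<in> E" | i where "i \<in> {1..n}" "{v, w} = {i, i + n}"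
      by (auto simp: whiskering_def)
    then show False
    proof cases
      case 1
      then show ?thesis using * vw edge_subset[OF 1] by (auto simp: indep_def)
    next
      case 2
      then have "i \<in> S" "i + n \<in> S" using vw by (metis insert_iff doubleton_eq_iff)+
      then show ?thesis using * 2 by blast
    qed
  qed
qed (auto simp: indep_def whiskering_def)

lemma facet_base: "T \<subseteq> {1..n} \<Longrightarrow> facet T \<inter> {1..n} = T"
  by (auto simp: facet_def)

lemma indep_facet: "T \<in> indeps \<Longrightarrow> indep (facet T) (whiskering n E)"
  unfolding indep_whiskering_iff using facet_base[of T] by (auto simp: indeps_def facet_def)

text \<open>A vertex \<open>i + n\<close> of \<open>S\<close> excludes \<open>i\<close> because of
  the whisker, hence lies in the facet over the low part of \<open>S\<close>.\<close>

lemma indep_subset_facet: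
  assumes "S \<subseteq> {1..2*n}" "indep S (whiskering n E)"
  shows "S \<inter> {1..n} \<in> indeps" "S \<subseteq> facet (S \<inter> {1..n})"
proof -
  show "S \<inter> {1..n} \<in> indeps" using assms by (simp add: indeps_def indep_whiskering_iff)
  show "S \<subseteq> facet (S \<inter> {1..n})"
  proof
    fix v assume v: "v \<in> S"
    show "v \<in> facet (S \<inter> {1..n})"
    proof (cases "v \<le> n")
      case True
      then show ?thesis using v assms(1) by (auto simp: facet_def)
    next
      case False
      then have "v = (v - n) + n" "v - n \<in> {1..n}" using v assms(1) by auto
      moreover from this have "v - n \<notin> S" using v assms(2) by (metis indep_whiskering_iff)
      ultimately show ?thesis unfolding facet_def by blast
    qed
  qed
qed

text \<open>The facets form an antichain, since adding \<open>i\<close> to \<open>T\<close> removes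
  \<open>i + n\<close> from the facet. This gives their maximality.\<close>

lemma facet_subset_iff:
  assumes "T \<subseteq> {1..n}" "T' \<subseteq> {1..n}"
  shows "facet T \<subseteq> facet T' \<longleftrightarrow> T = T'"
proof
  assume sub: "facet T \<subseteq> facet T'"
  have "T \<subseteq> T'" using sub facet_base[OF assms(1)] facet_base[OF assms(2)] by blast
  moreover have "i \<in> T" if "i \<in> T'" for i
  proof (rule ccontr)
    assume "i \<notin> T"
    then have "i \<in> {1..n} - T" using that assms by blast
    then have "i + n \<in> facet T'" using sub unfolding facet_def by blast
    then show False
      using subsetD[OF assms(2), of "i + n"] subsetD[OF assms(2), of i] that by (auto simp: facet_def)
  qed
  ultimately show "T = T'" by blast
qed simp

lemma max_indep_sets_whiskering: "max_indep_sets {1..2*n} (whiskering n E) = facet ` indeps"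
proof (intro equalityI subsetI)
  fix S assume S: "S \<in> max_indep_sets {1..2*n} (whiskering n E)"
  then have S': "S \<subseteq> {1..2*n}" "indep S (whiskering n E)" by (auto simp: max_indep_sets_def)
  let ?T = "S \<inter> {1..n}"
  have T: "?T \<in> indeps" "S \<subseteq> facet ?T" using indep_subset_facet[OF S'] by auto
  have "facet ?T \<subseteq> {1..2*n}" by (auto simp: facet_def)
  then have "\<not> S \<subset> facet ?T"
    using S indep_facet[OF T(1)] unfolding max_indep_sets_def by blast
  then have "S = facet ?T" using T(2) by blast
  then show "S \<in> facet ` indeps" using T by blast
next
  fix S assume "S \<in> facet ` indeps"
  then obtain T where T: "T \<in> indeps" "S = facet T" by blast
  have "\<not> indep S' (whiskering n E)" if "S \<subset> S'" "S' \<subseteq> {1..2*n}" for S'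
  proof
    assume "indep S' (whiskering n E)"
    then have S': "S' \<inter> {1..n} \<in> indeps" "S' \<subseteq> facet (S' \<inter> {1..n})"
      using indep_subset_facet that by auto
    then have "facet T \<subseteq> facet (S' \<inter> {1..n})" using T that by blast
    then have "T = S' \<inter> {1..n}" using facet_subset_iff T by (auto simp: indeps_def)
    then show False using S' T that by auto
  qed
  moreover have "S \<subseteq> {1..2*n}" using T by (auto simp: facet_def indeps_def)
  ultimately show "S \<in> max_indep_sets {1..2*n} (whiskering n E)"
    using T indep_facet by (auto simp: max_indep_sets_def)
qed

definition base :: "nat \<Rightarrow> nat set"
  where "base k = Fs k \<inter> {1..n}"

lemma base_indeps: "k \<in> {1..m} \<Longrightarrow> base k \<in> indeps"
  and Fs_eq_facet: "k \<in> {1..m} \<Longrightarrow> Fs k = facet (base k)"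
proof -
  assume "k \<in> {1..m}"
  then have "Fs k \<in> facet ` indeps"
    using facets unfolding max_indep_sets_whiskering by (metis bij_betw_imp_surj_on image_eqI)
  then obtain T where T: "T \<in> indeps" "Fs k = facet T" by blast
  then have "base k = T" using facet_base by (auto simp: base_def indeps_def)
  with T show "base k \<in> indeps" "Fs k = facet (base k)" by auto
qed

lemma base_subset: "k \<in> {1..m} \<Longrightarrow> base k \<subseteq> {1..n}"
  by (auto simp: base_def)

lemma base_inject: "k \<in> {1..m} \<Longrightarrow> l \<in> {1..m} \<Longrightarrow> base k = base l \<longleftrightarrow> k = l"
  using Fs_eq_facet[of k] Fs_eq_facet[of l] facets by (metis bij_betw_def inj_onD)

lemma base_surj: "T \<in> indeps \<Longrightarrow> \<exists>k\<in>{1..m}. base k = T"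
proof -
  assume T: "T \<in> indeps"
  then obtain k where "k \<in> {1..m}" "Fs k = facet T"
    using facets unfolding max_indep_sets_whiskering bij_betw_def by (metis image_iff)
  moreover from this have "base k = T" using T facet_base by (simp add: base_def indeps_def)
  ultimately show ?thesis by blast
qed

sublocale facet_form m "2*n" Fs
proof
  fix k assume "k \<in> {1..m}"
  then show "Fs k \<subseteq> {1..2*n}" using facets by (auto simp: bij_betw_def max_indep_sets_def)
qed

lemma Fs_low: "k \<in> {1..m} \<Longrightarrow> i \<in> {1..n} \<Longrightarrow> i \<in> Fs k \<longleftrightarrow> i \<in> base k"
  by (auto simp: base_def)

lemma Fs_high: "k \<in> {1..m} \<Longrightarrow> i \<in> {1..n} \<Longrightarrow> i + n \<in> Fs k \<longleftrightarrow> i \<notin> base k"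
  using Fs_eq_facet[of k] base_subset[of k] by (auto simp: facet_def)

section \<open>Quadrics in the annihilator and their leading monomials\<close>

definition monomial_part :: "(pvar, 'k::field) mpoly set"
  where "monomial_part = {monom (Poly_Mapping.single v 1 + Poly_Mapping.single w 1) |v w.
    v \<in> V \<and> w \<in> V \<and> (v = w \<or> (\<forall>k\<in>{1..m}. \<not> {v, w} \<subseteq> W k))}"

definition binomial_part :: "(pvar, 'k::field) mpoly set"
  where "binomial_part = {monom (sqf {Xvar k, Uvar i}) - monom (sqf {Xvar l, Uvar (i + n)}) |k l i.
    k \<in> {1..m} \<and> l \<in> {1..m} \<and> i \<in> {1..n} \<and> i \<in> base k \<and> base l = base k - {i}}"

lemma monomial_partI:
  "v \<in> V \<Longrightarrow> w \<in> V \<Longrightarrow> v = w \<or> (\<forall>k\<in>{1..m}. \<not> {v, w} \<subseteq> W k) \<Longrightarrow>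
    monom (Poly_Mapping.single v 1 + Poly_Mapping.single w 1) \<in> monomial_part"
  unfolding monomial_part_def by (intro CollectI exI conjI) (rule refl)

lemma binomial_partI:
  "k \<in> {1..m} \<Longrightarrow> l \<in> {1..m} \<Longrightarrow> i \<in> {1..n} \<Longrightarrow> i \<in> base k \<Longrightarrow> base l = base k - {i} \<Longrightarrow>
    monom (sqf {Xvar k, Uvar i}) - monom (sqf {Xvar l, Uvar (i + n)}) \<in> binomial_part"
  unfolding binomial_part_def by (intro CollectI exI conjI) (rule refl)

lemma monomial_part_Ann: "monomial_part \<subseteq> Ann V (graph_form m Fs :: (pvar, 'k::field) mpoly)"
proof
  fix b :: "(pvar, 'k) mpoly" assume "b \<in> monomial_part"
  then obtain v w where vw: "b = monom (Poly_Mapping.single v 1 + Poly_Mapping.single w 1)"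
    "v \<in> V" "w \<in> V" "v = w \<or> (\<forall>k\<in>{1..m}. \<not> {v, w} \<subseteq> W k)"
    unfolding monomial_part_def by (elim CollectE exE conjE) (rule that)
  let ?t = "Poly_Mapping.single v 1 + Poly_Mapping.single w (1::nat)"
  have "sqf (W k - Y) \<noteq> ?t" if "k \<in> {1..m}" for k Y
  proof
    assume t: "sqf (W k - Y) = ?t"
    have fin: "finite (W k - Y)" using finite_W that by simp
    have "lookup ?t v \<le> 1" "keys ?t \<subseteq> W k" unfolding t[symmetric] using fin by (auto simp: lookup_sqf)
    then have "v \<noteq> w" "{v, w} \<subseteq> W k"
      by (auto simp: lookup_add lookup_single when_def in_keys_iff subset_iff)
    with vw that show False by blast
  qed
  then have "lookup b (sqf (W k - Y)) = 0" if "k \<in> {1..m}" for k Y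
    using that unfolding vw(1) lookup_monom by simp
  then have "pairing b Y = 0" for Y
    unfolding pairing_def by (intro sum.neutral) simp
  moreover have "b \<in> polys V"
    unfolding vw(1) using vw(2,3) keys_add[of "Poly_Mapping.single v 1" "Poly_Mapping.single w (1::nat)"]
    by (auto simp: polys_def monomials_def monom_def split: if_splits)
  ultimately show "b \<in> Ann V (graph_form m Fs)" by (simp add: Ann_graph_form_iff)
qed

text \<open>Exchanging \<open>i\<close> for \<open>i + n\<close> turns the facet \<open>Fs k\<close>
  into \<open>Fs l\<close>. Hence both monomials have the same complement in their respective
  \<open>W k\<close> and \<open>W l\<close>, and act on the form with the same result.\<close>

lemma binomial_part_Ann: "binomial_part \<subseteq> Ann V (graph_form m Fs :: (pvar, 'k::field) mpoly)"
proof
  fix b :: "(pvar, 'k) mpoly" assume "b \<in> binomial_part"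
  then obtain k l i where b: "b = monom (sqf {Xvar k, Uvar i}) - monom (sqf {Xvar l, Uvar (i + n)})"
    and kli: "k \<in> {1..m}" "l \<in> {1..m}" "i \<in> {1..n}" "i \<in> base k" "base l = base k - {i}"
    unfolding binomial_part_def by (elim CollectE exE conjE) (rule that)
  have sub: "{Xvar k, Uvar i} \<subseteq> W k" "{Xvar l, Uvar (i + n)} \<subseteq> W l"
    using kli by (auto simp: Fs_low Fs_high)
  have "Fs k - {i} = Fs l - {i + n}"
  proof -
    have "{1..n} - (base k - {i}) = insert i ({1..n} - base k)" using kli(3,4) by blast
    then have l: "Fs l = (base k - {i}) \<union> insert (i + n) ((\<lambda>j. j + n) ` ({1..n} - base k))"
      unfolding Fs_eq_facet[OF kli(2)] facet_def kli(5) by simp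
    have k: "Fs k = base k \<union> (\<lambda>j. j + n) ` ({1..n} - base k)"
      unfolding Fs_eq_facet[OF kli(1)] by (simp add: facet_def)
    have "i \<notin> (\<lambda>j. j + n) ` ({1..n} - base k)" using kli(3) by auto
    moreover have "i + n \<notin> base k" using subsetD[OF base_subset[OF kli(1)], of "i + n"] kli(3) by auto
    moreover have "i + n \<notin> (\<lambda>j. j + n) ` ({1..n} - base k)" using kli(4) by auto
    ultimately show ?thesis unfolding k l by blast
  qed
  moreover have "W k - {Xvar k, Uvar i} = Uvar ` (Fs k - {i})"
    "W l - {Xvar l, Uvar (i + n)} = Uvar ` (Fs l - {i + n})"
    by (auto simp: W_def)
  ultimately have "W k - {Xvar k, Uvar i} = W l - {Xvar l, Uvar (i + n)}" by simp
  then have "pairing b Y = 0" for Y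
    unfolding b pairing_diff
    by (subst pairing_monom_Xvar[OF kli(1) _ sub(1)], simp,
        subst pairing_monom_Xvar[OF kli(2) _ sub(2)], simp, simp)
  moreover have "b \<in> polys V"
  proof -
    have "keys b \<subseteq> {sqf {Xvar k, Uvar i}, sqf {Xvar l, Uvar (i + n)}}"
      by (auto simp: b in_keys_iff lookup_minus lookup_monom split: if_splits)
    then show ?thesis
      using order_trans[OF sub(1) W_subset[OF kli(1)]] order_trans[OF sub(2) W_subset[OF kli(2)]]
      unfolding polys_def by (fastforce simp: sqf_in_monomials)
  qed
  ultimately show "b \<in> Ann V (graph_form m Fs)" by (simp add: Ann_graph_form_iff)
qed

text \<open>The monomials first differ at \<open>u_i\<close>, because \<open>u_i\<close> precedes
  \<open>u_(i + n)\<close> and every \<open>u\<close> precedes every \<open>x\<close>.\<close>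

lemma leading_monomial_binomial_part:
  assumes "k \<in> {1..m}" "l \<in> {1..m}" "i \<in> {1..n}" "i \<in> base k" "base l = base k - {i}"
  shows "leading_monomial (lex_order V)
    (monom (sqf {Xvar k, Uvar i}) - monom (sqf {Xvar l, Uvar (i + n)}) :: (pvar, 'k::field) mpoly) =
    sqf {Xvar k, Uvar i}" (is "leading_monomial _ ?b = _")
proof (rule leading_monomial_lex_orderI)
  have "?b \<in> binomial_part" using assms by (rule binomial_partI)
  then show "?b \<in> polys V" using binomial_part_Ann by (auto simp: Ann_def)
  have "sqf {Xvar l, Uvar (i + n)} < sqf {Xvar k, Uvar i}"
    by (rule sqf_less_sqf[of _ _ "Uvar i"]) (use assms in \<open>auto simp: less_Uvar_iff\<close>)
  then show "sqf {Xvar k, Uvar i} \<in> keys ?b"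
    and "s \<in> keys ?b \<Longrightarrow> s \<le> sqf {Xvar k, Uvar i}" for s
    by (auto simp: in_keys_iff lookup_minus lookup_monom split: if_splits)
qed

text \<open>A leading monomial \<open>t\<close> divisible by no generator's would be squarefree with
  any two of its variables in a common \<open>W k\<close>. Its coefficient is then shown to vanish,
  separately for \<open>t\<close> without and with a variable \<open>x_k\<close>.\<close>

lemma leading_monomial_divisible:
  assumes f: "f \<in> Ann V (graph_form m Fs :: (pvar, 'k::field) mpoly)" "f \<noteq> 0"
  shows "\<exists>b\<in>monomial_part \<union> binomial_part. \<exists>u\<in>monomials V.
    leading_monomial (lex_order V) f = u + leading_monomial (lex_order V) (b :: (pvar, 'k) mpoly)"
proof (rule ccontr)
  assume contr: "\<not> ?thesis"
  define t where "t = leading_monomial (lex_order V) f"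
  have fV: "f \<in> polys V" using f by (simp add: Ann_def)
  have t: "t \<in> keys f" "\<And>s. s \<in> keys f \<Longrightarrow> s \<le> t"
    unfolding t_def using leading_monomial_lex_order[OF fV f(2)] by auto
  have tV: "t \<in> monomials V" using fV t(1) by (auto simp: polys_def)
  have sub_monomials: "u \<in> monomials V" if "t = u + s" for u s
    using tV that by (auto simp: monomials_def in_keys_iff lookup_add)
  have no_pair: False if vw: "v \<in> V" "w \<in> V" "v = w \<or> (\<forall>k\<in>{1..m}. \<not> {v, w} \<subseteq> W k)"
    and u: "t = u + (Poly_Mapping.single v 1 + Poly_Mapping.single w 1)" for v w u
  proof -
    let ?s = "Poly_Mapping.single v 1 + Poly_Mapping.single w (1::nat)"
    have "?s \<in> monomials V" using sub_monomials[of ?s u] u by (simp add: add.commute)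
    then have "leading_monomial (lex_order V) (monom ?s :: (pvar, 'k) mpoly) = ?s"
      by (rule leading_monomial_lex_order_monom)
    moreover have "(monom ?s :: (pvar, 'k) mpoly) \<in> monomial_part"
      using vw by (rule monomial_partI)
    ultimately show False
      using contr u sub_monomials[OF u] unfolding t_def[symmetric] by (metis UnI1)
  qed
  have "lookup t v \<le> 1" for v
  proof (rule ccontr)
    assume v: "\<not> lookup t v \<le> 1"
    then have "v \<in> V" using tV by (auto simp: monomials_def in_keys_iff)
    moreover have "t = (t - Poly_Mapping.single v 2) + (Poly_Mapping.single v 1 + Poly_Mapping.single v 1)"
      by (rule poly_mapping_eqI) (use v in \<open>auto simp: lookup_add lookup_minus lookup_single when_def\<close>)
    ultimately show False using no_pair by blast
  qed
  then have t_sqf: "t = sqf (keys t)" by (rule sqf_of_squarefree)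
  define Z where "Z = keys t"
  have Z: "finite Z" "t = sqf Z" "Z \<subseteq> V" using t_sqf tV by (auto simp: Z_def monomials_def)
  have split: "t = sqf (Z - {v, w}) + (Poly_Mapping.single v 1 + Poly_Mapping.single w 1)"
    if "v \<in> Z" "w \<in> Z" "v \<noteq> w" for v w
    using sqf_split[OF Z(1), of "{v, w}"] that by (simp add: Z sqf_insert add.commute)
  have compat: "\<exists>k\<in>{1..m}. v \<in> W k \<and> w \<in> W k" if "v \<in> Z" "w \<in> Z" "v \<noteq> w" for v w
    using no_pair[OF _ _ _ split[OF that]] that Z by auto
  show False
  proof (cases "\<exists>k. Xvar k \<in> Z")
    case False
    define \<sigma> where "\<sigma> = {j. Uvar j \<in> Z}"
    have "v \<in> Uvar ` \<sigma>" if "v \<in> Z" for v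
      using that False by (cases v) (auto simp: \<sigma>_def)
    then have Z\<sigma>: "Z = Uvar ` \<sigma>" by (auto simp: \<sigma>_def)
    have \<sigma>: "\<sigma> \<subseteq> {1..2*n}" using Z(3) by (auto simp: \<sigma>_def xu_vars_def)
    have compat': "\<exists>k\<in>{1..m}. i \<in> Fs k \<and> j \<in> Fs k" if "i \<in> \<sigma>" "j \<in> \<sigma>" "i \<noteq> j" for i j
      using compat[of "Uvar i" "Uvar j"] that by (auto simp: \<sigma>_def)
    \<comment> \<open>Independence is a condition on pairs, so pairwise compatibility already makes
      \<open>\<sigma>\<close> a face.\<close>
    have "indep \<sigma> (whiskering n E)"
      unfolding indep_def
    proof (intro ballI impI)
      fix i j assume ij: "i \<in> \<sigma>" "j \<in> \<sigma>" "i \<noteq> j"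
      then obtain k where k: "k \<in> {1..m}" "i \<in> Fs k" "j \<in> Fs k" using compat' by blast
      then have "indep (Fs k) (whiskering n E)"
        using indep_facet[OF base_indeps] Fs_eq_facet by metis
      then show "{i, j} \<notin> whiskering n E" using k ij by (simp add: indep_def)
    qed
    then have "\<sigma> \<inter> {1..n} \<in> indeps" "\<sigma> \<subseteq> facet (\<sigma> \<inter> {1..n})"
      using indep_subset_facet \<sigma> by auto
    then have "\<sigma> \<in> faces (card \<sigma>)"
      unfolding faces_def using base_surj Fs_eq_facet by (metis (mono_tags, lifting) mem_Collect_eq)
    then have "lookup f t = 0" using lookup_face_Ann[OF f(1)] by (simp add: Z(2) Z\<sigma>)
    then show False using t by (simp add: in_keys_iff)
  next
    case True
    then obtain k where kZ: "Xvar k \<in> Z" by blast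
    then have k: "k \<in> {1..m}" using Z by (auto simp: xu_vars_def)
    \<comment> \<open>Since \<open>Xvar k\<close> lies in \<open>W k\<close> only, any variable
      compatible with it does too.\<close>
    have ZW: "Z \<subseteq> W k"
      using compat[OF kZ] kZ by fastforce
    \<comment> \<open>Otherwise \<open>t\<close> is divisible by \<open>x_k u_i\<close>, the leading
      monomial of the binomial that replaces \<open>i\<close> by \<open>i + n\<close>.\<close>
    have low: "Uvar i \<notin> Z" if i: "i \<in> {1..n}" for i
    proof
      assume iZ: "Uvar i \<in> Z"
      then have "i \<in> base k" using ZW i k by (auto simp: Fs_low)
      moreover have "base k - {i} \<in> indeps"
        using base_indeps[OF k] by (auto simp: indeps_def intro: smaller_indep)
      then obtain l where l: "l \<in> {1..m}" "base l = base k - {i}" using base_surj by blast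
      ultimately have lm: "leading_monomial (lex_order V)
          (monom (sqf {Xvar k, Uvar i}) - monom (sqf {Xvar l, Uvar (i + n)}) :: (pvar, 'k) mpoly) =
          sqf {Xvar k, Uvar i}" (is "leading_monomial _ ?b = _")
        using leading_monomial_binomial_part k i by blast
      have "?b \<in> binomial_part"
        using k l(1) i \<open>i \<in> base k\<close> l(2) by (rule binomial_partI)
      moreover have u: "t = sqf (Z - {Xvar k, Uvar i}) + sqf {Xvar k, Uvar i}"
        using sqf_split[OF Z(1), of "{Xvar k, Uvar i}"] iZ kZ by (simp add: Z add.commute)
      ultimately show False
        using contr lm sub_monomials[OF u] unfolding t_def[symmetric] by (metis UnI2)
    qed
    \<comment> \<open>In the pairing at this complement the summand of \<open>k\<close> is the
      coefficient of \<open>t\<close>; the other summands will vanish because their monomials exceed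
      \<open>t\<close>.\<close>
    define Y where "Y = W k - Z"
    have Y: "finite Y" "W k - Y = Z" "Y \<subseteq> W k"
      using finite_W[OF k] ZW by (auto simp: Y_def)
    have baseY: "Uvar ` base k \<subseteq> Y"
      using low base_subset[OF k] k by (auto simp: Y_def base_def)
    have "lookup f (sqf (W l - Y)) = 0" if l: "l \<in> {1..m}" "Y \<subseteq> W l" "l \<noteq> k" for l
    proof -
      have "base k \<subseteq> base l"
      proof
        fix j assume j: "j \<in> base k"
        then have "Uvar j \<in> W l" using baseY l(2) by blast
        then show "j \<in> base l" using j by (simp add: base_def)
      qed
      moreover have "base l \<noteq> base k" using l k base_inject by blast
      ultimately have ne: "base l - base k \<noteq> {}" by blast
      \<comment> \<open>The first variable in which \<open>sqf (W l - Y)\<close> and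
        \<open>t\<close> differ is \<open>u_i\<close>: smaller elements of \<open>base l\<close> lie
        in \<open>base k\<close>, whose variables belong to \<open>Y\<close>, and \<open>Z\<close>
        has no low variables at all.\<close>
      define i where "i = Min (base l - base k)"
      have fin: "finite (base l - base k)" using base_subset[OF l(1)] finite_subset by blast
      have i: "i \<in> base l" "i \<notin> base k" using Min_in[OF fin ne] by (auto simp: i_def)
      have below: "j \<in> base k" if "j \<in> base l" "j < i" for j
        using Min_le[OF fin, of j] that by (auto simp: i_def)
      have i': "i \<in> {1..n}" using i base_subset l by blast
      have "sqf Z < sqf (W l - Y)"
      proof (rule sqf_less_sqf[of _ _ "Uvar i"])
        have "Uvar i \<notin> Y" using Y(3) i i' k by (auto simp: Fs_low)
        then show "Uvar i \<in> W l - Y - Z" using i i' l low by (simp add: Fs_low)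
        fix w assume "w < Uvar i"
        then obtain j where j: "j < i" "w = Uvar j" by (auto simp: less_Uvar_iff)
        have "Uvar j \<notin> W l - Y"
        proof
          assume *: "Uvar j \<in> W l - Y"
          then have "j \<in> Fs l" by simp
          then have "j \<in> base l" using j i' facet_subset[OF l(1)] by (auto simp: base_def)
          with below j baseY * show False by blast
        qed
        moreover have "Uvar j \<notin> Z"
        proof
          assume "Uvar j \<in> Z"
          moreover from this have "j \<in> {1..n}" using j i' Z(3) by (auto simp: xu_vars_def)
          ultimately show False using low by blast
        qed
        ultimately show "w \<in> Z \<longleftrightarrow> w \<in> W l - Y" using j by simp
      qed (use Z finite_W l in auto)
      then have "sqf (W l - Y) \<notin> keys f" using t(2) Z(2) by (metis leD)
      then show ?thesis by (simp add: in_keys_iff)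
    qed
    then have "pairing f Y = (\<Sum>l\<in>{k}. lookup f (sqf (W l - Y)))"
      unfolding pairing_def by (intro sum.mono_neutral_right) (use k Y in auto)
    also have "\<dots> = lookup f t" using Y Z by simp
    finally show False using f(1) Y(1) t(1) by (simp add: Ann_graph_form_iff in_keys_iff)
  qed
qed

theorem G_quadratic_graph_form: "G_quadratic V (Ann V (graph_form m Fs :: (pvar, 'k::field) mpoly))"
  unfolding G_quadratic_def
proof (intro exI conjI ballI)
  let ?I = "Ann V (graph_form m Fs :: (pvar, 'k) mpoly)"
  let ?B = "monomial_part \<union> binomial_part :: (pvar, 'k) mpoly set"
  show "monomial_order V (lex_order V)" by (rule monomial_order_lex_order)
  have ne: "sqf {Xvar k, Uvar i} \<noteq> sqf {Xvar l, Uvar (i + n)}" if "i \<in> {1..n}" for k l i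
    using that by (simp add: sqf_inject doubleton_eq_iff)
  have nz: "b \<noteq> 0" if "b \<in> ?B" for b
  proof -
    have "\<exists>t. lookup b t = 1"
      using that ne by (fastforce simp: monomial_part_def binomial_part_def lookup_monom lookup_minus)
    then show ?thesis by auto
  qed
  show "groebner_basis V (lex_order V) ?I ?B"
  proof (rule groebner_basis_lex_orderI)
    show "?I \<subseteq> polys V" by (auto simp: Ann_def)
    have "monomial_part \<subseteq>
        (\<Union>v\<in>V. \<Union>w\<in>V. {monom (Poly_Mapping.single v 1 + Poly_Mapping.single w 1) :: (pvar, 'k) mpoly})"
      unfolding monomial_part_def
      by (intro subsetI, elim CollectE exE conjE, erule UN_I, erule UN_I) simp
    then have "finite (monomial_part :: (pvar, 'k) mpoly set)"
      by (rule finite_subset) simp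
    moreover have "binomial_part \<subseteq> (\<Union>k\<in>{1..m}. \<Union>l\<in>{1..m}. \<Union>i\<in>{1..n}.
        {monom (sqf {Xvar k, Uvar i}) - monom (sqf {Xvar l, Uvar (i + n)}) :: (pvar, 'k) mpoly})"
      unfolding binomial_part_def
      by (intro subsetI, elim CollectE exE conjE, erule UN_I, erule UN_I, erule UN_I) simp
    then have "finite (binomial_part :: (pvar, 'k) mpoly set)"
      by (rule finite_subset) simp
    ultimately show "finite ?B" by simp
    show "?B \<subseteq> ?I - {0}" using nz monomial_part_Ann binomial_part_Ann by blast
  qed (rule leading_monomial_divisible)
  have deg: "mon_degree (Poly_Mapping.single v 1 + Poly_Mapping.single w 1) = 2" for v w :: pvar
  proof (cases "v = w")
    case True
    then have "Poly_Mapping.single v 1 + Poly_Mapping.single w (1::nat) = Poly_Mapping.single v 2"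
      by (simp add: numeral_2_eq_2 flip: single_add)
    then show ?thesis by (simp add: mon_degree_def)
  next
    case False
    then have "Poly_Mapping.single v 1 + Poly_Mapping.single w (1::nat) = sqf {v, w}"
      by (simp add: sqf_insert)
    then show ?thesis using False by (simp add: mon_degree_sqf)
  qed
  fix b :: "(pvar, 'k) mpoly" assume "b \<in> ?B"
  then show "homogeneous 2 b"
  proof
    assume "b \<in> monomial_part"
    then show ?thesis using deg by (auto simp: monomial_part_def homogeneous_def monom_def)
  next
    assume "b \<in> binomial_part"
    then obtain k l i where b: "b = monom (sqf {Xvar k, Uvar i}) - monom (sqf {Xvar l, Uvar (i + n)})"
      unfolding binomial_part_def by (elim CollectE exE conjE) (rule that)
    have "keys b \<subseteq> {sqf {Xvar k, Uvar i}, sqf {Xvar l, Uvar (i + n)}}"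
      by (auto simp: b in_keys_iff lookup_minus lookup_monom split: if_splits)
    moreover have "mon_degree (sqf {Xvar k, Uvar j}) = 2" for k j
      by (simp add: mon_degree_sqf)
    ultimately show ?thesis unfolding homogeneous_def by blast
  qed
qed

end

section \<open>Face numbers\<close>

definition catalan :: "nat \<Rightarrow> real"
  where "catalan r = real (2 * r choose r) / (real r + 1)"

lemma catalan_pos: "catalan r > 0"
  by (simp add: catalan_def zero_less_binomial_iff)

lemma Suc_mult_choose_Suc: "Suc r * (N choose Suc r) = (N - r) * (N choose r)"
  by (simp only: binomial_absorption binomial_absorb_comp)

text \<open>The ratio of consecutive entries in row \<open>N\<close> is
  \<open>(N - r) / (r + 1)\<close>, which is at most 1 here.\<close>

lemma choose_Suc_le: "N \<le> 2 * r + 1 \<Longrightarrow> N choose Suc r \<le> N choose r"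
proof -
  assume "N \<le> 2 * r + 1"
  then have "Suc r * (N choose Suc r) \<le> Suc r * (N choose r)"
    unfolding Suc_mult_choose_Suc by (intro mult_right_mono) auto
  then show ?thesis by (simp only: mult_le_cancel1)
qed

lemma catalan_right: "real (2 * r choose r) - real (2 * r choose Suc r) = catalan r"
proof -
  have "real (Suc r * (2 * r choose Suc r)) = real (r * (2 * r choose r))"
    by (subst Suc_mult_choose_Suc) simp
  then have "(real r + 1) * real (2 * r choose Suc r) = real r * real (2 * r choose r)"
    by (simp only: of_nat_mult of_nat_Suc add.commute[of 1])
  then show ?thesis by (simp add: catalan_def field_simps del: binomial_Suc_Suc)
qed

lemma catalan_left: "real (2 * Suc r choose Suc r) - real (2 * Suc r choose r) = catalan (Suc r)"
proof -
  have "2 * Suc r choose r = 2 * Suc r choose Suc (Suc r)"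
    by (subst binomial_symmetric) auto
  then show ?thesis using catalan_right[of "Suc r"] by simp
qed

text \<open>Expanding \<open>catalan_left\<close> in row \<open>2 * r + 4\<close> by Pascal's rule
  cancels a common term; symmetry of row \<open>2 * r + 3\<close> does the rest.\<close>

lemma catalan_odd:
  "real (2 * r + 3 choose Suc r) - real (2 * r + 3 choose r) = catalan (r + 2)"
proof -
  have "2 * r + 3 choose Suc (Suc r) = 2 * r + 3 choose Suc r"
    by (subst binomial_symmetric) auto
  moreover have "2 * Suc (Suc r) = Suc (2 * r + 3)" by simp
  ultimately show ?thesis
    using catalan_left[of "Suc r"] by (simp only: binomial_Suc_Suc of_nat_add) simp
qed

text \<open>Pascal's rule applied twice writes the central coefficient of row
  \<open>2 * r + 2\<close> as four entries of row \<open>2 * r\<close>, each at most the central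
  one; the larger denominator only helps.\<close>

lemma catalan_Suc_le: "catalan (Suc r) \<le> 4 * catalan r"
proof -
  have "2 * Suc r choose Suc r \<le> 4 * (2 * r choose r)"
  proof (cases r)
    case (Suc q)
    have "2 * Suc r choose Suc r = (2 * r choose q) + 2 * (2 * r choose r) + (2 * r choose Suc r)"
      by (simp add: Suc)
    moreover have "2 * r choose q \<le> 2 * r choose r" "2 * r choose Suc r \<le> 2 * r choose r"
      using binomial_maximum[of "2 * r"] by simp_all
    ultimately show ?thesis by simp
  qed simp
  then have "real (2 * Suc r choose Suc r) \<le> 4 * real (2 * r choose r)"
    by (metis of_nat_le_iff of_nat_mult of_nat_numeral)
  then have "catalan (Suc r) \<le> 4 * real (2 * r choose r) / (real (Suc r) + 1)"
    unfolding catalan_def by (intro divide_right_mono) auto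
  also have "\<dots> \<le> 4 * real (2 * r choose r) / (real r + 1)"
    by (intro divide_left_mono) auto
  finally show ?thesis by (simp add: catalan_def)
qed

text \<open>Only the differences at \<open>K\<close>, some of them possibly negative, need
  computing; all others are nonnegative.\<close>

lemma weighted_sum_less:
  fixes c x y :: "nat \<Rightarrow> nat"
  assumes "finite J" "K \<subseteq> J" "\<And>j. j \<in> J - K \<Longrightarrow> x j \<le> y j"
    and "0 < (\<Sum>j\<in>K. real (c j) * (real (y j) - real (x j)))"
  shows "(\<Sum>j\<in>J. c j * x j) < (\<Sum>j\<in>J. c j * y j)"
proof -
  have "(\<Sum>j\<in>K. real (c j) * (real (y j) - real (x j))) \<le> (\<Sum>j\<in>J. real (c j) * (real (y j) - real (x j)))"
    by (rule sum_mono2) (use assms in \<open>auto intro!: mult_nonneg_nonneg\<close>)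
  with assms(4) have "0 < (\<Sum>j\<in>J. real (c j) * (real (y j) - real (x j)))" by linarith
  then have "real (\<Sum>j\<in>J. c j * x j) < real (\<Sum>j\<in>J. c j * y j)"
    by (simp add: algebra_simps sum_subtractf)
  then show ?thesis by (simp only: of_nat_less_iff)
qed

text \<open>Below, \<open>c j\<close> is the number of independent sets with \<open>j\<close> elements of the graph \<open>H\<close>.\<close>

lemma f_vector_less_even:
  fixes c :: "nat \<Rightarrow> nat"
  assumes "k \<ge> 2" "c 0 = 1" "c 2 \<ge> 5"
  shows "(\<Sum>j\<le>2 * k. c j * (2 * k - j choose k)) < (\<Sum>j\<le>2 * k. c j * (2 * k - j choose (k - 1)))"
\<comment> \<open>Index 0 contributes \<open>- catalan k\<close> and index 2 contributes
  \<open>c 2 * catalan (k - 1)\<close>. Catalan numbers grow at most by the factor 4, so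
  \<open>c 2 \<ge> 5\<close> suffices.\<close>
proof (rule weighted_sum_less[where K = "{0, 2}"])
  obtain r where k: "k = Suc r" using assms(1) by (cases k) auto
  fix j assume "j \<in> {..2 * k} - {0, 2}"
  then have "2 * k - j \<le> 2 * r + 1" by (auto simp: k)
  then show "2 * k - j choose k \<le> 2 * k - j choose (k - 1)"
    unfolding k using choose_Suc_le by simp
next
  obtain r where k: "k = Suc r" using assms(1) by (cases k) auto
  have "catalan (Suc r) < real (c 2) * catalan r"
  proof -
    have "catalan (Suc r) \<le> 4 * catalan r" by (rule catalan_Suc_le)
    also have "\<dots> < real (c 2) * catalan r"
      using assms(3) catalan_pos[of r] by (intro mult_strict_right_mono) auto
    finally show ?thesis .
  qed
  moreover have "2 * k - 2 = 2 * r" by (simp add: k)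
  ultimately show "0 < (\<Sum>j\<in>{0, 2}. real (c j) * (real (2 * k - j choose (k - 1)) - real (2 * k - j choose k)))"
    using catalan_left[of r] catalan_right[of r] assms(2)
    by (simp add: k del: binomial_Suc_Suc mult_Suc_right)
qed (use assms in auto)

text \<open>Indices 0 and 1 lose \<open>catalan (r + 4) + c 1 * catalan (r + 3)\<close>, at most
  \<open>16 + 4 * (2 * r + 7) = 8 * r + 44\<close> times \<open>catalan (r + 2)\<close>. Indices 3
  and 4 each gain \<open>catalan (r + 2)\<close> per independent set.\<close>

lemma f_vector_less_odd:
  fixes c :: "nat \<Rightarrow> nat"
  assumes "c 0 = 1" "c 1 \<le> 2 * r + 7" "c 3 + c 4 > 8 * r + 44"
  shows "(\<Sum>j\<le>2 * r + 7. c j * (2 * r + 7 - j choose (r + 3))) <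
    (\<Sum>j\<le>2 * r + 7. c j * (2 * r + 7 - j choose (r + 2)))"
proof (rule weighted_sum_less[where K = "{0, 1, 3, 4}"])
  fix j assume "j \<in> {..2 * r + 7} - {0, 1, 3, 4}"
  then have "j \<noteq> 0" "j \<noteq> 1" by auto
  then have "2 * r + 7 - j \<le> 2 * (r + 2) + 1" by arith
  then show "2 * r + 7 - j choose (r + 3) \<le> 2 * r + 7 - j choose (r + 2)"
    using choose_Suc_le[of "2 * r + 7 - j" "r + 2"] by (simp add: numeral_3_eq_3)
next
  define D where "D j = real (2 * r + 7 - j choose (r + 2)) - real (2 * r + 7 - j choose (r + 3))" for j
  have "D 0 = - catalan (r + 4)"
    using catalan_odd[of "r + 2"] by (simp add: D_def eval_nat_numeral del: binomial_Suc_Suc)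
  moreover have "D 1 = - catalan (r + 3)"
    using catalan_left[of "r + 2"] by (simp add: D_def eval_nat_numeral del: binomial_Suc_Suc)
  moreover have "D 3 = catalan (r + 2)"
    using catalan_right[of "r + 2"] by (simp add: D_def eval_nat_numeral del: binomial_Suc_Suc)
  moreover have "D 4 = catalan (r + 2)"
  proof -
    have "2 * r + 3 choose (r + 2) = 2 * r + 3 choose Suc r" "2 * r + 3 choose (r + 3) = 2 * r + 3 choose r"
      by (subst binomial_symmetric; simp)+
    moreover have "2 * r + 7 - 4 = 2 * r + 3" by simp
    ultimately show ?thesis using catalan_odd[of r] by (simp only: D_def)
  qed
  moreover have "catalan (r + 3) \<le> 4 * catalan (r + 2)" "catalan (r + 4) \<le> 4 * catalan (r + 3)"
    using catalan_Suc_le[of "r + 2"] catalan_Suc_le[of "r + 3"] by (simp_all add: eval_nat_numeral)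
  moreover have "real (c 1) * catalan (r + 3) \<le> real (2 * r + 7) * (4 * catalan (r + 2))"
    using assms(2) calculation(5) catalan_pos[of "r + 3"] by (intro mult_mono) (auto intro: less_imp_le)
  moreover have "(8 * real r + 44) * catalan (r + 2) < real (c 3 + c 4) * catalan (r + 2)"
    using assms(3) catalan_pos[of "r + 2"] by (intro mult_strict_right_mono) linarith+
  ultimately show "0 < (\<Sum>j\<in>{0, 1, 3, 4}. real (c j) * (real (2 * r + 7 - j choose (r + 2)) -
      real (2 * r + 7 - j choose (r + 3))))"
    unfolding D_def[symmetric] using assms(1) by (simp add: algebra_simps)
qed auto

text \<open>All rows are at most \<open>2 * r + 1\<close>, so no index loses, and index 1 gains
  \<open>c 1 * catalan r\<close>.\<close>

lemma f_vector_less_odd_below: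
  fixes c :: "nat \<Rightarrow> nat"
  assumes "c 1 > 0"
  shows "(\<Sum>j\<le>2 * r + 1. c j * (2 * r + 1 - j choose (r + 1))) <
    (\<Sum>j\<le>2 * r + 1. c j * (2 * r + 1 - j choose r))"
proof (rule weighted_sum_less[where K = "{1}"])
  fix j
  show "2 * r + 1 - j choose (r + 1) \<le> 2 * r + 1 - j choose r"
    using choose_Suc_le[of "2 * r + 1 - j" r] by simp
next
  show "0 < (\<Sum>j\<in>{1}. real (c j) * (real (2 * r + 1 - j choose r) - real (2 * r + 1 - j choose (r + 1))))"
    using catalan_right[of r] catalan_pos[of r] assms by simp
qed auto

text \<open>For \<open>k = r + 4\<close> the right side is the \<open>8 * r + 44\<close> of
  \<open>f_vector_less_odd\<close>. At \<open>k = 7\<close> the claim is \<open>70 > 68\<close>, and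
  each step adds at least 21 on the left.\<close>

lemma choose_4_lower_bound: "k \<ge> 7 \<Longrightarrow> (k choose 3) + (k choose 4) > 8 * k + 12"
proof (induction k rule: dec_induct)
  case base
  show ?case by (simp add: eval_nat_numeral)
next
  case (step k)
  have "k choose 2 \<ge> 7 choose 2" by (rule binomial_right_mono) (use step in auto)
  then have "k choose 2 \<ge> 21" by (simp add: eval_nat_numeral)
  then show ?case using step.IH by (simp add: eval_nat_numeral)
qed

section \<open>Face numbers of the complex of independent sets of a whiskered graph\<close>

context whiskered_form
begin

lemma card_facet: "T \<subseteq> {1..n} \<Longrightarrow> card (facet T) = n"
proof -
  assume T: "T \<subseteq> {1..n}"
  then have fin: "finite T" using finite_subset by blast
  have "card (facet T) = card T + card ((\<lambda>i. i + n) ` ({1..n} - T))"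
    unfolding facet_def
  proof (rule card_Un_disjoint)
    have "x \<le> n" if "x \<in> T" for x using subsetD[OF T that] by simp
    then show "T \<inter> (\<lambda>i. i + n) ` ({1..n} - T) = {}" by force
  qed (use fin in auto)
  also have "card ((\<lambda>i. i + n) ` ({1..n} - T)) = n - card T"
    using T by (simp add: card_image card_Diff_subset fin)
  finally show ?thesis using card_mono[OF _ T] by simp
qed

lemma card_Fs: "k \<in> {1..m} \<Longrightarrow> card (Fs k) = n"
  using card_facet[OF base_subset] Fs_eq_facet by simp

lemma finite_indeps: "finite indeps"
  by (rule finite_subset[of _ "Pow {1..n}"]) (auto simp: indeps_def)

text \<open>A face is determined by its intersection \<open>T\<close> with \<open>{1..n}\<close> and the set \<open>C\<close> of the indices
  \<open>i\<close> such that it contains neither \<open>i\<close> nor \<open>i + n\<close>.\<close>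

lemma faces_eq:
  assumes "k \<le> n"
  shows "faces k = (\<lambda>(T, C). facet T - (\<lambda>i. i + n) ` C) `
    (SIGMA T:indeps. {C. C \<subseteq> {1..n} - T \<and> card C = n - k})"
proof (intro equalityI subsetI)
  fix \<sigma> assume \<sigma>: "\<sigma> \<in> faces k"
  then obtain l where l: "l \<in> {1..m}" "\<sigma> \<subseteq> Fs l" "card \<sigma> = k" by (auto simp: faces_def)
  define T where "T = \<sigma> \<inter> {1..n}"
  define C where "C = {i \<in> {1..n} - T. i + n \<notin> \<sigma>}"
  have "indep \<sigma> (whiskering n E)"
    using indep_facet[OF base_indeps[OF l(1)]] l(2) smaller_indep unfolding Fs_eq_facet[OF l(1), symmetric] by blast
  then have T: "T \<in> indeps" "\<sigma> \<subseteq> facet T"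
    using indep_subset_facet faces_subset[OF \<sigma>] unfolding T_def by auto
  have eq: "\<sigma> = facet T - (\<lambda>i. i + n) ` C"
  proof (intro equalityI subsetI)
    fix x assume "x \<in> \<sigma>"
    then show "x \<in> facet T - (\<lambda>i. i + n) ` C" using T(2) by (auto simp: C_def)
  next
    fix x assume x: "x \<in> facet T - (\<lambda>i. i + n) ` C"
    then consider "x \<in> T" | i where "x = i + n" "i \<in> {1..n} - T" by (auto simp: facet_def)
    then show "x \<in> \<sigma>"
      by cases (use x in \<open>auto simp: T_def C_def\<close>)
  qed
  have "(\<lambda>i. i + n) ` C \<subseteq> facet T" by (auto simp: facet_def C_def)
  then have "k = n - card C"
    using T(1) card_facet[of T] l(3) unfolding eq
    by (subst (asm) card_Diff_subset) (auto simp: C_def card_image indeps_def)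
  moreover have "card C \<le> n"
    using card_mono[of "{1..n}" C] unfolding C_def by fastforce
  ultimately have "(T, C) \<in> (SIGMA T:indeps. {C. C \<subseteq> {1..n} - T \<and> card C = n - k})"
    using T by (auto simp: C_def)
  then show "\<sigma> \<in> (\<lambda>(T, C). facet T - (\<lambda>i. i + n) ` C) `
      (SIGMA T:indeps. {C. C \<subseteq> {1..n} - T \<and> card C = n - k})"
    by (rule rev_image_eqI) (simp add: eq)
next
  fix \<sigma> assume "\<sigma> \<in> (\<lambda>(T, C). facet T - (\<lambda>i. i + n) ` C) `
      (SIGMA T:indeps. {C. C \<subseteq> {1..n} - T \<and> card C = n - k})"
  then obtain T C where TC: "T \<in> indeps" "C \<subseteq> {1..n} - T" "card C = n - k"
    "\<sigma> = facet T - (\<lambda>i. i + n) ` C" by auto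
  obtain l where l: "l \<in> {1..m}" "Fs l = facet T"
    using base_surj[OF TC(1)] Fs_eq_facet by blast
  have "(\<lambda>i. i + n) ` C \<subseteq> facet T" using TC(2) by (auto simp: facet_def)
  moreover have "finite C" using TC(2) finite_subset by blast
  ultimately have "card \<sigma> = k"
    using TC(1,3) assms card_facet[of T] unfolding TC(4)
    by (subst card_Diff_subset) (auto simp: card_image indeps_def)
  then show "\<sigma> \<in> faces k" using l TC(4) by (auto simp: faces_def)
qed

text \<open>The pairs \<open>(T, C)\<close> of \<open>faces_eq\<close> are counted by the size
  \<open>j\<close> of \<open>T\<close>; the binomial coefficient counts the choices of
  \<open>C\<close> outside \<open>T\<close>.\<close>

lemma card_faces:
  assumes "k \<le> n"
  shows "card (faces k) = (\<Sum>j\<le>n. card {T \<in> indeps. card T = j} * (n - j choose (n - k)))"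
proof -
  let ?f = "\<lambda>(T, C). facet T - (\<lambda>i. i + n) ` C"
  let ?S = "SIGMA T:indeps. {C. C \<subseteq> {1..n} - T \<and> card C = n - k}"
  have "inj_on ?f ?S"
  proof (rule inj_on_inverseI[where g = "\<lambda>\<sigma>. (\<sigma> \<inter> {1..n}, {i \<in> {1..n} - \<sigma>. i + n \<notin> \<sigma>})"])
    fix p assume "p \<in> ?S"
    then obtain T C where p: "p = (T, C)" "T \<subseteq> {1..n}" "C \<subseteq> {1..n} - T" by (auto simp: indeps_def)
    have T: "(facet T - (\<lambda>i. i + n) ` C) \<inter> {1..n} = T"
    proof -
      have "i + n \<notin> T" if "i \<in> C" for i
        using subsetD[OF p(2), of "i + n"] subsetD[OF p(3) that] by auto
      then show ?thesis using p(2) by (auto simp: facet_def)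
    qed
    have high: "i + n \<in> facet T \<longleftrightarrow> i \<notin> T" if "i \<in> {1..n}" for i
      using that subsetD[OF p(2), of "i + n"] by (auto simp: facet_def)
    have "{i \<in> {1..n} - (facet T - (\<lambda>i. i + n) ` C). i + n \<notin> facet T - (\<lambda>i. i + n) ` C} =
        {i \<in> {1..n} - T. i + n \<notin> facet T - (\<lambda>i. i + n) ` C}" using T by blast
    also have "\<dots> = C" using high p(3) by auto
    finally show "(?f p \<inter> {1..n}, {i \<in> {1..n} - ?f p. i + n \<notin> ?f p}) = p"
      using T by (simp add: p(1))
  qed
  then have "card (faces k) = card ?S"
    by (simp add: faces_eq[OF assms] card_image)
  also have "\<dots> = (\<Sum>T\<in>indeps. card {C. C \<subseteq> {1..n} - T \<and> card C = n - k})"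
    by (rule card_SigmaI) (auto simp: finite_indeps)
  also have "\<dots> = (\<Sum>T\<in>indeps. n - card T choose (n - k))"
  proof (rule sum.cong)
    fix T assume "T \<in> indeps"
    then have "T \<subseteq> {1..n}" "finite T" using finite_subset by (auto simp: indeps_def)
    then have "card ({1..n} - T) = n - card T" by (simp add: card_Diff_subset)
    then show "card {C. C \<subseteq> {1..n} - T \<and> card C = n - k} = n - card T choose (n - k)"
      using n_subsets[of "{1..n} - T" "n - k"] by simp
  qed simp
  also have "\<dots> = (\<Sum>j\<le>n. \<Sum>T\<in>{T \<in> indeps. card T = j}. n - card T choose (n - k))"
  proof (rule sum.group[symmetric])
    show "card ` indeps \<subseteq> {..n}"
      using card_mono[of "{1..n}"] by (fastforce simp: indeps_def)
  qed (auto simp: finite_indeps)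
  also have "\<dots> = (\<Sum>j\<le>n. card {T \<in> indeps. card T = j} * (n - j choose (n - k)))"
    by (intro sum.cong refl) simp
  finally show ?thesis .
qed

text \<open>Subsets of independent sets are independent, so one large \<open>P\<close> bounds the
  number of independent sets of every size from below.\<close>

lemma card_indeps_ge:
  assumes "P \<subseteq> {1..n}" "indep P E"
  shows "card P choose j \<le> card {T \<in> indeps. card T = j}"
proof -
  have "{T. T \<subseteq> P \<and> card T = j} \<subseteq> {T \<in> indeps. card T = j}"
    using assms smaller_indep by (auto simp: indeps_def)
  then have "card {T. T \<subseteq> P \<and> card T = j} \<le> card {T \<in> indeps. card T = j}"
    by (rule card_mono[rotated]) (simp add: finite_indeps)
  then show ?thesis using n_subsets[of P j] assms(1) finite_subset by fastforce
qed

lemma card_indeps_0: "card {T \<in> indeps. card T = 0} = 1"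
proof -
  have "finite T" if "T \<in> indeps" for T using that finite_subset by (auto simp: indeps_def)
  then have "{T \<in> indeps. card T = 0} = {{}}" by (auto simp: indeps_def)
  then show ?thesis by simp
qed

lemma card_indeps_1: "card {T \<in> indeps. card T = 1} = n"
proof -
  have "{T \<in> indeps. card T = 1} = (\<lambda>i. {i}) ` {1..n}"
    by (auto simp: indeps_def indep_def card_1_singleton_iff)
  then show ?thesis by (simp add: card_image)
qed

theorem not_weak_Lefschetz_whiskering:
  assumes n: "n \<ge> 12" and P: "P \<subseteq> {1..n}" "indep P E" "2 * card P \<ge> n"
  shows "\<not> weak_Lefschetz (macaulay_algebra V (graph_form m Fs :: (pvar, 'k::field) mpoly))
             (graded_piece V (Ann V (graph_form m Fs :: (pvar, 'k) mpoly)))"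
proof -
  define c where "c j = card {T \<in> indeps. card T = j}" for j
  have c: "c 0 = 1" "c 1 = n" "\<And>j. card P choose j \<le> c j"
    using card_indeps_0 card_indeps_1 card_indeps_ge[OF P(1,2)] by (simp_all add: c_def)
  have f: "card (faces k) = (\<Sum>j\<le>n. c j * (n - j choose (n - k)))" if "k \<le> n" for k
    using card_faces[OF that] by (simp add: c_def)
  show ?thesis
  proof (cases "even n")
    case True
    then obtain k where k: "n = 2 * k" by blast
    \<comment> \<open>From \<open>n \<ge> 12\<close> the set \<open>P\<close> has at least 6
      elements, hence 15 pairs.\<close>
    have "6 choose 2 \<le> card P choose 2" by (rule binomial_right_mono) (use n P(3) in auto)
    then have "c 2 \<ge> 5" using c(3)[of 2] by (simp add: eval_nat_numeral)
    then have "card (faces k) < card (faces (Suc k))"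
      using f_vector_less_even[of k c] c(1) n f[of k] f[of "Suc k"] by (simp add: k)
    \<comment> \<open>For even \<open>n\<close> the middle degree is its own dual, so one inequality
      serves for both obstructions.\<close>
    then show ?thesis
      by (intro not_weak_Lefschetz_graph_form[where i = k and j = k and d = n] card_Fs) (simp_all add: k)
  next
    case False
    define r where "r = (n - 7) div 2"
    have r: "n = 2 * r + 7" using False n unfolding r_def by presburger
    have p: "r + 4 \<le> card P" using P(3) r by simp
    \<comment> \<open>An odd \<open>n \<ge> 12\<close> is at least 13, so \<open>r \<ge> 3\<close>
      and \<open>r + 4\<close> reaches the bound 7.\<close>
    have "8 * (r + 4) + 12 < (r + 4 choose 3) + (r + 4 choose 4)"
      by (rule choose_4_lower_bound) (use n r in simp)
    also have "\<dots> \<le> c 3 + c 4"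
      by (intro add_mono order_trans[OF binomial_right_mono[OF p] c(3)])
    finally have "card (faces (r + 4)) < card (faces (Suc (r + 4)))"
      using f_vector_less_odd[of c r] c(1,2) f[of "r + 4"] f[of "Suc (r + 4)"]
      by (simp add: r add.commute[of 3])
    \<comment> \<open>The index dual to \<open>r + 4\<close> is \<open>n - (r + 4) = r + 3\<close>,
      and \<open>n = 2 * (r + 3) + 1\<close>.\<close>
    moreover have "card (faces (r + 3)) < card (faces (Suc (r + 3)))"
      using f_vector_less_odd_below[of c "r + 3"] c(2) n f[of "r + 3"] f[of "Suc (r + 3)"]
      by (simp add: r add.commute[of 3] add.commute[of 7])
    ultimately show ?thesis
      by (intro not_weak_Lefschetz_graph_form[where i = "r + 4" and j = "r + 3" and d = n] card_Fs)
        (simp_all add: r)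
  qed
qed

section \<open>The Perazzo property\<close>

lemma facet_iff:
  "T \<subseteq> {1..n} \<Longrightarrow> j \<in> facet T \<longleftrightarrow> j \<in> T \<or> (n < j \<and> j \<le> 2 * n \<and> j - n \<notin> T)"
proof -
  assume T: "T \<subseteq> {1..n}"
  have "j \<in> (\<lambda>i. i + n) ` ({1..n} - T) \<longleftrightarrow> n < j \<and> j \<le> 2 * n \<and> j - n \<notin> T"
    by (auto simp: image_iff intro!: bexI[of _ "j - n"])
  then show ?thesis by (simp add: facet_def)
qed

text \<open>Distinct facets have distinct monomials, hence linear independence; two nonadjacent
  vertices of \<open>H\<close> yield a binomial relation among four of these monomials.\<close>

theorem perazzo_form_whiskering:
  assumes ab: "a \<in> {1..n}" "b \<in> {1..n}" "a \<noteq> b" "{a, b} \<notin> E"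
  shows "perazzo_form m (2 * n) (graph_form m Fs :: (pvar, 'k::field) mpoly)"
proof -
  let ?F = "graph_form m Fs :: (pvar, 'k) mpoly"
  define g :: "nat \<Rightarrow> (pvar, 'k) mpoly" where "g k = (\<Prod>j\<in>Fs k. var (Uvar j))" for k
  have g: "g k = monom (sqf (Uvar ` Fs k))" if "k \<in> {1..m}" for k
    unfolding g_def using prod_var_image[OF finite_facet[OF that], of Uvar] by (simp add: inj_on_def)
  have fin: "finite (Uvar ` Fs k)" if "k \<in> {1..m}" for k using finite_facet[OF that] by simp
  have "form ?F"
    unfolding form_def homogeneous_def
  proof (intro exI ballI)
    fix t assume "t \<in> keys ?F"
    then obtain k where k: "k \<in> {1..m}" "t = sqf (W k)" using keys_graph_form by blast
    have "card (W k) = Suc n"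
      using card_Fs[OF k(1)] finite_facet[OF k(1)] unfolding W_def
      by (subst card_insert_disjoint) (auto simp: card_image inj_on_def)
    then show "mon_degree t = Suc n" using k finite_W by (simp add: mon_degree_sqf)
  qed
  moreover have "g k \<in> polys (Uvar ` {1..2 * n})" "form (g k)" if k: "k \<in> {1..m}" for k
    using facet_subset[OF k] fin[OF k]
    by (auto simp: g[OF k] polys_def monom_def sqf_in_monomials form_def homogeneous_def)
  moreover have "0 \<in> polys (Uvar ` {1..2 * n})" by (simp add: polys_def)
  moreover have "?F = (\<Sum>i=1..m. var (Xvar i) * g i) + 0" by (simp add: graph_form_def g_def)
  moreover have "linearly_independent {1..m} g"
    unfolding linearly_independent_def
  proof (intro allI impI ballI)
    fix c :: "nat \<Rightarrow> 'k" and k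
    assume 0: "(\<Sum>i\<in>{1..m}. const (c i) * g i) = 0" and k: "k \<in> {1..m}"
    have "sqf (Uvar ` Fs k) = sqf (Uvar ` Fs i) \<longleftrightarrow> i = k" if "i \<in> {1..m}" for i
      using sqf_inject[OF fin[OF that] fin[OF k]] inj_image_eq_iff[of Uvar "Fs i" "Fs k"]
        base_inject[OF that k] by (auto simp: base_def inj_def)
    then have "(\<Sum>i\<in>{1..m}. lookup (const (c i) * g i) (sqf (Uvar ` Fs k))) =
        (\<Sum>i\<in>{1..m}. if i = k then c i else 0)"
      by (intro sum.cong refl) (simp add: g lookup_const_mult lookup_monom)
    also have "\<dots> = c k" using k by simp
    finally show "c k = 0" using 0 by (simp flip: lookup_sum)
  qed
  moreover have "algebraically_dependent {1..m} g"
  proof -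
    have ind: "{} \<in> indeps" "{a} \<in> indeps" "{b} \<in> indeps" "{a, b} \<in> indeps"
      using ab by (auto simp: indeps_def indep_def insert_commute)
    obtain k0 where k0: "k0 \<in> {1..m}" "base k0 = {}" using base_surj[OF ind(1)] by blast
    obtain ka where ka: "ka \<in> {1..m}" "base ka = {a}" using base_surj[OF ind(2)] by blast
    obtain kb where kb: "kb \<in> {1..m}" "base kb = {b}" using base_surj[OF ind(3)] by blast
    obtain kab where kab: "kab \<in> {1..m}" "base kab = {a, b}" using base_surj[OF ind(4)] by blast
    have ne: "k0 \<noteq> ka" "k0 \<noteq> kb" "k0 \<noteq> kab" "ka \<noteq> kb" "ka \<noteq> kab" "kb \<noteq> kab"
      using k0 ka kb kab ab(3) by auto
    \<comment> \<open>The relation is \<open>g k0 * g kab = g ka * g kb\<close>.\<close>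
    let ?P = "monom (sqf {k0, kab}) - monom (sqf {ka, kb}) :: (nat, 'k) mpoly"
    have sqf_ne: "sqf {k0, kab} \<noteq> sqf {ka, kb}"
      using ne by (simp add: sqf_inject doubleton_eq_iff)
    then have keys: "keys ?P = {sqf {k0, kab}, sqf {ka, kb}}"
      by (auto simp: in_keys_iff lookup_minus lookup_monom split: if_splits)
    have ne0: "?P \<noteq> 0" using keys by (metis keys_zero insert_not_empty)
    have prod: "(\<Prod>i\<in>keys (sqf {k, l}). g i ^ lookup (sqf {k, l}) i) =
        monom (sqf (Uvar ` Fs k) + sqf (Uvar ` Fs l))" if "k \<in> {1..m}" "l \<in> {1..m}" "k \<noteq> l" for k l
      using that by (simp add: lookup_sqf g monom_mult)
    \<comment> \<open>Each of \<open>a\<close>, \<open>b\<close>, \<open>a + n\<close>,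
      \<open>b + n\<close> lies in exactly one of the two facets on either side, and every other
      \<open>i + n\<close> in all four.\<close>
    have "sqf (Uvar ` Fs k0) + sqf (Uvar ` Fs kab) = sqf (Uvar ` Fs ka) + sqf (Uvar ` Fs kb)"
    proof (rule poly_mapping_eqI)
      fix v
      show "lookup (sqf (Uvar ` Fs k0) + sqf (Uvar ` Fs kab)) v = lookup (sqf (Uvar ` Fs ka) + sqf (Uvar ` Fs kb)) v"
      proof (cases v)
        case (Uvar j)
        have mem: "j \<in> Fs k \<longleftrightarrow> j \<in> base k \<or> (n < j \<and> j \<le> 2 * n \<and> j - n \<notin> base k)" if "k \<in> {1..m}" for k
          using facet_iff[OF base_subset[OF that]] Fs_eq_facet[OF that] by simp
        have U: "Uvar j \<in> Uvar ` S \<longleftrightarrow> j \<in> S" for S by auto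
        show ?thesis
          using ab unfolding Uvar lookup_add lookup_sqf[OF fin[OF k0(1)]] lookup_sqf[OF fin[OF ka(1)]]
            lookup_sqf[OF fin[OF kb(1)]] lookup_sqf[OF fin[OF kab(1)]] U
            mem[OF k0(1)] mem[OF ka(1)] mem[OF kb(1)] mem[OF kab(1)] k0(2) ka(2) kb(2) kab(2)
          by auto
      qed (use fin k0 ka kb kab in \<open>auto simp: lookup_add lookup_sqf\<close>)
    qed
    then have "msubst g ?P = 0"
      unfolding msubst_def keys using sqf_ne prod[OF k0(1) kab(1) ne(3)] prod[OF ka(1) kb(1) ne(4)]
      by (simp add: lookup_minus lookup_monom)
        (simp add: poly_mapping_eq_iff fun_eq_iff lookup_add lookup_const_mult)
    moreover have "?P \<in> polys {1..m}"
      unfolding polys_def mem_Collect_eq keys using k0 ka kb kab by (simp add: sqf_in_monomials)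
    ultimately show ?thesis using ne0 unfolding algebraically_dependent_def by blast
  qed
  ultimately show ?thesis unfolding perazzo_form_def by blast
qed

end

theorem theorem1p2:
  fixes n m :: nat and E :: "nat set set" and Fs :: "nat \<Rightarrow> nat set"
    and F :: "(pvar, 'k::field_char_0) mpoly"
  assumes "n \<ge> 12"
    and "simple_graph {1..n} E"
    and "bipartite {1..n} E"
    and "bij_betw Fs {1..m} (max_indep_sets {1..2*n} (whiskering n E))"
    and "F = graph_form m Fs"
  shows "perazzo_form m (2*n) F \<and>
         G_quadratic (xu_vars m (2*n)) (Ann (xu_vars m (2*n)) F) \<and>
         \<not> weak_Lefschetz (macaulay_algebra (xu_vars m (2*n)) F)
             (graded_piece (xu_vars m (2*n)) (Ann (xu_vars m (2*n)) F))"
proof -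
  interpret whiskered_form n m E Fs
    using assms by unfold_locales (auto simp: simple_graph_def)
  obtain A B where AB: "A \<union> B = {1..n}" "A \<inter> B = {}" "\<And>e. e \<in> E \<Longrightarrow> \<exists>a\<in>A. \<exists>b\<in>B. e = {a, b}"
    using assms(3) by (auto simp: bipartite_def)
  \<comment> \<open>Every edge joins \<open>A\<close> to \<open>B\<close>, so neither side contains
    both of its ends.\<close>
  have "indep A E" "indep B E"
    using AB(2,3) by (fastforce simp: indep_def doubleton_eq_iff)+
  moreover have "card A + card B = n"
    using card_Un_disjoint[of A B] AB(1,2) by (metis card_atLeastAtMost diff_Suc_1 finite_Un finite_atLeastAtMost)
  \<comment> \<open>The larger side of the bipartition serves as \<open>P\<close>.\<close>
  ultimately obtain P where P: "P \<subseteq> {1..n}" "indep P E" "2 * card P \<ge> n"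
    using AB(1) by (metis Un_upper1 Un_upper2 add_le_mono le_cases mult_2 nat_le_linear add.commute)
  \<comment> \<open>Two elements of \<open>P\<close> are the nonadjacent vertices needed for the
    algebraic relation.\<close>
  have "card P \<ge> 2" using P(3) assms(1) by simp
  then obtain a b where "a \<in> P" "b \<in> P" "a \<noteq> b"
    by (metis card_2_iff' obtain_subset_with_card_n subsetD)
  then have "a \<in> {1..n}" "b \<in> {1..n}" "a \<noteq> b" "{a, b} \<notin> E"
    using P by (auto simp: indep_def)
  then show ?thesis
    unfolding assms(5)
    using perazzo_form_whiskering G_quadratic_graph_form not_weak_Lefschetz_whiskering[OF assms(1) P]
    by blast
qed

end
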